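(* Let $A$ be a computably enumerable set such that $A\not\leq_C\emptyset$, and let $X$ be a $\Delta^0_2$ set such that $X\not\leq_C\emptyset$. Then there are computably enumerable sets $A_0,A_1$ with $A_0\cap A_1=\emptyset$ and $A=A_0\cup A_1$ such that $A_0\not\leq_C A_1$, $A_1\not\leq_C A_0$, and for each $i\in\{0,1\}$: $A_i\leq_C A$, $A\not\leq_C A_i$, and $X\not\leq_C A_i$.
   Context: Sets are identified with their binary characteristic sequences; $Y\restriction_n$ is the string of the first $n$ bits of $Y$. $C$ denotes plain Kolmogorov complexity with respect to a fixed optimal machine. For sets $Y,Z$, $Y\leq_C Z$ means there is a constant $c$ with $C(Y\restriction_n)\leq C(Z\restriction_n)+c$ for all $n$; in particular $Y\leq_C\emptyset$ means $C(Y\restriction_n)\leq C(n)+c$ for some $c$ and all $n$ (equivalently, $Y$ is computable). *)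

theory Defs
  imports Main "HOL-Library.Extended_Nat"
begin

datatype recf = Zr | Sc | Proj nat | Cn recf "recf list" | Pr recf recf | Mn recf

inductive eval :: "recf \<Rightarrow> nat list \<Rightarrow> nat \<Rightarrow> bool" where
  eval_Zr: "eval Zr xs 0"
| eval_Sc: "eval Sc (x # xs) (Suc x)"
| eval_Proj: "i < length xs \<Longrightarrow> eval (Proj i) xs (xs ! i)"
| eval_Cn: "list_all2 (\<lambda>g y. eval g xs y) gs ys \<Longrightarrow> eval f ys z \<Longrightarrow> eval (Cn f gs) xs z"
| eval_Pr0: "eval f xs y \<Longrightarrow> eval (Pr f g) (0 # xs) y"
| eval_PrS: "eval (Pr f g) (n # xs) y \<Longrightarrow> eval g (n # y # xs) z \<Longrightarrow> eval (Pr f g) (Suc n # xs) z"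
| eval_Mn: "eval f (n # xs) 0 \<Longrightarrow> (\<forall>m<n. \<exists>y. eval f (m # xs) y \<and> y \<noteq> 0) \<Longrightarrow> eval (Mn f) xs n"

definition ce :: "nat set \<Rightarrow> bool" where
  "ce A \<longleftrightarrow> (\<exists>r. A = {x. \<exists>y. eval r [x] y})"

definition computable_rel3 :: "(nat \<Rightarrow> nat \<Rightarrow> nat \<Rightarrow> bool) \<Rightarrow> bool" where
  "computable_rel3 R \<longleftrightarrow> (\<exists>r. \<forall>x a b. eval r [x, a, b] (if R x a b then 1 else 0))"

definition Sigma02 :: "nat set \<Rightarrow> bool" where
  "Sigma02 X \<longleftrightarrow> (\<exists>R. computable_rel3 R \<and> X = {x. \<exists>a. \<forall>b. R x a b})"

definition Delta02 :: "nat set \<Rightarrow> bool" where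
  "Delta02 X \<longleftrightarrow> Sigma02 X \<and> Sigma02 (- X)"

text \<open>Standard bijection between binary strings and naturals: w maps to (1w in binary) - 1.\<close>
definition str_code :: "bool list \<Rightarrow> nat" where
  "str_code w = foldl (\<lambda>acc b. 2 * acc + (if b then 1 else 0)) 1 w - 1"

definition partial_computable :: "(bool list \<Rightarrow> bool list option) \<Rightarrow> bool" where
  "partial_computable M \<longleftrightarrow>
     (\<exists>r. \<forall>p n. eval r [str_code p] n \<longleftrightarrow> (\<exists>y. M p = Some y \<and> n = str_code y))"

definition KC :: "(bool list \<Rightarrow> bool list option) \<Rightarrow> bool list \<Rightarrow> enat" where
  "KC M x = (INF p \<in> {p. M p = Some x}. enat (length p))"

definition optimal_machine :: "(bool list \<Rightarrow> bool list option) \<Rightarrow> bool" where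
  "optimal_machine U \<longleftrightarrow> partial_computable U \<and>
     (\<forall>M. partial_computable M \<longrightarrow> (\<exists>c::nat. \<forall>x. KC U x \<le> KC M x + enat c))"

definition U_opt :: "bool list \<Rightarrow> bool list option" where
  "U_opt = (SOME U. optimal_machine U)"

definition C :: "bool list \<Rightarrow> enat" where
  "C x = KC U_opt x"

definition restr :: "nat set \<Rightarrow> nat \<Rightarrow> bool list" where
  "restr Y n = map (\<lambda>i. i \<in> Y) [0..<n]"

definition leqC :: "nat set \<Rightarrow> nat set \<Rightarrow> bool" (infix "\<le>\<^sub>C" 50) where
  "Y \<le>\<^sub>C Z \<longleftrightarrow> (\<exists>c::nat. \<forall>n. C (restr Y n) \<le> C (restr Z n) + enat c)"

end

theory Submission
  imports Defs "HOL-Library.Nat_Bijection"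
begin

text \<open>
  This is a Sacks splitting with complexities in place of oracle computations. An element that
  enters \<open>A\<close> is put into the half that is not protected by the requirement of
  strongest priority restraining it. The requirement for a target \<open>Z\<close> (which is
  \<open>A\<close> or \<open>X\<close>), a half \<open>A\<^sub>i\<close> and a constant
  \<open>c\<close> restrains \<open>A\<^sub>i\<close> on every length up to which, at some
  earlier stage, the approximated complexities witnessed \<open>C(Z|m) \<le> C(A\<^sub>i|m) +
  c\<close>. If such a restraint grew without bound, then \<open>A\<^sub>i\<close> would be
  computable and the inequality would hold for all \<open>m\<close>, so that \<open>Z\<close>
  would be below the empty set. Hence all restraints are finite, which means that each inequality
  fails for some \<open>m\<close>.

  Incomparability of the halves is then free: the half whose initial segment of length
  \<open>n\<close> settles last determines that of \<open>A\<close>, so \<open>C(A|n)\<close>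
  is at most the larger one of \<open>C(A\<^sub>0|n)\<close> and \<open>C(A\<^sub>1|n)\<close>
  up to a constant, and if the halves were comparable, then \<open>A\<close> would be below one of
  them.
\<close>

section \<open>Total recursive functions\<close>

inductive_cases eval_ZrE: "eval Zr xs y"
inductive_cases eval_ScE: "eval Sc xs y"
inductive_cases eval_ProjE: "eval (Proj i) xs y"
inductive_cases eval_CnE: "eval (Cn f gs) xs y"
inductive_cases eval_Pr0E: "eval (Pr f g) (0 # xs) y"
inductive_cases eval_PrSE: "eval (Pr f g) (Suc n # xs) y"
inductive_cases eval_MnE: "eval (Mn f) xs y"

lemma eval_deterministic:
  assumes "eval r xs y" and "eval r xs z"
  shows "y = z"
  using assms
proof (induction arbitrary: z rule: eval.induct)
  case (eval_Zr xs)
  then show ?case by (rule eval_ZrE) simp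
next
  case (eval_Sc x xs)
  then show ?case by (rule eval_ScE) simp
next
  case (eval_Proj i xs)
  from eval_Proj.prems show ?case by (rule eval_ProjE) simp
next
  case (eval_Cn xs gs ys f y)
  from eval_Cn.prems obtain ys' where ys': "list_all2 (\<lambda>g y. eval g xs y) gs ys'" "eval f ys' z"
    by (auto elim: eval_CnE)
  have "ys = ys'"
    using eval_Cn.IH(1) ys'(1) by (auto simp: list_all2_conv_all_nth intro!: nth_equalityI)
  then show ?case using eval_Cn.IH(2) ys'(2) by blast
next
  case (eval_Pr0 f xs y g)
  from eval_Pr0.prems show ?case by (rule eval_Pr0E) (use eval_Pr0.IH in blast)
next
  case (eval_PrS f g n xs y u)
  from eval_PrS.prems show ?case by (rule eval_PrSE) (use eval_PrS.IH in blast)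
next
  case (eval_Mn f n xs)
  from eval_Mn.prems obtain z0: "eval f (z # xs) 0"
    and zl: "\<forall>m<z. \<exists>y. eval f (m # xs) y \<and> y \<noteq> 0"
    by (auto elim: eval_MnE)
  have "\<not> z < n" using eval_Mn.IH(2) z0 by (metis neq0_conv)
  moreover have "\<not> n < z" using eval_Mn.IH(1) zl by (metis neq0_conv)
  ultimately show ?case by simp
qed

text \<open>The arguments of a function are the entries \<open>v 0\<close>, \<open>v 1\<close>, \<open>\<dots>\<close> of an environment, and the
  closure rules for binders shift them as de Bruijn indices.\<close>

definition env :: "nat list \<Rightarrow> nat \<Rightarrow> nat" where
  "env xs i = (if i < length xs then xs ! i else 0)"

lemma env_Cons [simp]: "env (x # xs) 0 = x" "env (x # xs) (Suc i) = env xs i"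
  by (simp_all add: env_def)

lemma env_Cons_tail [simp]: "(\<lambda>k. env (x # xs) (Suc k)) = env xs"
  by (simp add: fun_eq_iff)

text \<open>Arguments appear as \<open>v i\<close> in an ordinary term, so that
  \<open>intro rec_intros\<close> can prove recursiveness by following the shape of a definition's
  body.\<close>

definition rfun :: "nat \<Rightarrow> ((nat \<Rightarrow> nat) \<Rightarrow> nat) \<Rightarrow> bool" where
  "rfun n f \<longleftrightarrow> (\<exists>r. \<forall>xs. length xs = n \<longrightarrow> eval r xs (f (env xs)))"

definition rdec :: "nat \<Rightarrow> ((nat \<Rightarrow> nat) \<Rightarrow> bool) \<Rightarrow> bool" where
  "rdec n P \<longleftrightarrow> rfun n (\<lambda>v. of_bool (P v))"

named_theorems rec_intros

lemma rfun_var [rec_intros]: "i < n \<Longrightarrow> rfun n (\<lambda>v. v i)"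
  unfolding rfun_def
  by (rule exI[of _ "Proj i"]) (auto simp: env_def intro: eval_Proj)

lemma rfun_compose:
  assumes "rfun (length gs) F" and "\<forall>g\<in>set gs. rfun n g"
  shows "rfun n (\<lambda>v. F (env (map (\<lambda>g. g v) gs)))"
proof -
  obtain r where r: "\<And>ys. length ys = length gs \<Longrightarrow> eval r ys (F (env ys))"
    using assms(1) by (auto simp: rfun_def)
  obtain q where q: "\<And>g xs. g \<in> set gs \<Longrightarrow> length xs = n \<Longrightarrow> eval (q g) xs (g (env xs))"
    using assms(2) unfolding rfun_def by metis
  have "eval (Cn r (map q gs)) xs (F (env (map (\<lambda>g. g (env xs)) gs)))" if "length xs = n" for xs
    by (rule eval_Cn[where ys = "map (\<lambda>g. g (env xs)) gs"])
      (auto simp: list_all2_conv_all_nth that intro: q r)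
  then show ?thesis unfolding rfun_def by blast
qed

lemma rfun_comp1:
  assumes "rfun 1 (\<lambda>v. F (v 0))" and "rfun n a"
  shows "rfun n (\<lambda>v. F (a v))"
  using rfun_compose[of "[a]" "\<lambda>v. F (v 0)" n] assms by simp

lemma rfun_comp2:
  assumes "rfun 2 (\<lambda>v. F (v 0) (v 1))" and "rfun n a" and "rfun n b"
  shows "rfun n (\<lambda>v. F (a v) (b v))"
  using rfun_compose[of "[a, b]" "\<lambda>v. F (v 0) (v 1)" n] assms by (simp add: numeral_2_eq_2)

lemma rfun_comp3:
  assumes "rfun 3 (\<lambda>v. F (v 0) (v 1) (v 2))" and "rfun n a" and "rfun n b" and "rfun n c"
  shows "rfun n (\<lambda>v. F (a v) (b v) (c v))"
  using rfun_compose[of "[a, b, c]" "\<lambda>v. F (v 0) (v 1) (v 2)" n] assms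
  by (simp add: numeral_3_eq_3 numeral_2_eq_2)

lemma rdec_comp2:
  assumes "rdec 2 (\<lambda>v. P (v 0) (v 1))" and "rfun n a" and "rfun n b"
  shows "rdec n (\<lambda>v. P (a v) (b v))"
  using rfun_comp2[of "\<lambda>x y. of_bool (P x y)"] assms by (simp add: rdec_def)

lemma rdec_comp3:
  assumes "rdec 3 (\<lambda>v. P (v 0) (v 1) (v 2))" and "rfun n a" and "rfun n b" and "rfun n c"
  shows "rdec n (\<lambda>v. P (a v) (b v) (c v))"
  using rfun_comp3[of "\<lambda>x y z. of_bool (P x y z)"] assms by (simp add: rdec_def)

lemma rfun_Suc [rec_intros]:
  assumes "rfun n a"
  shows "rfun n (\<lambda>v. Suc (a v))"
proof (rule rfun_comp1[OF _ assms])
  have "eval Sc xs (Suc (env xs 0))" if "length xs = 1" for xs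
    using that by (cases xs) (auto intro: eval_Sc)
  then show "rfun 1 (\<lambda>v. Suc (v 0))" unfolding rfun_def by blast
qed

lemma rfun_const [rec_intros]: "rfun n (\<lambda>v. c)"
proof (induction c)
  case 0
  show ?case unfolding rfun_def using eval_Zr by blast
next
  case (Suc c)
  then show ?case by (rule rfun_Suc)
qed

text \<open>Two variables are bound, the counter \<open>m\<close> and the accumulator
  \<open>y\<close>, so the parameters of \<open>g\<close> move up by two. The number of iterations
  may be any recursive function of the environment, not just a variable.\<close>

lemma rfun_rec [rec_intros]:
  assumes f: "rfun n f" and g: "rfun (Suc (Suc n)) (\<lambda>v. g (v 0) (v (Suc 0)) (\<lambda>k. v (Suc (Suc k))))"
    and b: "rfun n b"
  shows "rfun n (\<lambda>v. rec_nat (f v) (\<lambda>m y. g m y v) (b v))"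
proof -
  obtain rf where rf: "\<And>xs. length xs = n \<Longrightarrow> eval rf xs (f (env xs))"
    using f by (auto simp: rfun_def)
  obtain rg where rg: "\<And>xs. length xs = Suc (Suc n) \<Longrightarrow>
      eval rg xs (g (env xs 0) (env xs (Suc 0)) (\<lambda>k. env xs (Suc (Suc k))))"
    using g by (auto simp: rfun_def)
  have *: "eval (Pr rf rg) (k # xs) (rec_nat (f (env xs)) (\<lambda>m y. g m y (env xs)) k)"
    if "length xs = n" for xs k
  proof (induction k)
    case 0
    show ?case using rf[OF that] by (simp add: eval_Pr0)
  next
    case (Suc k)
    show ?case using eval_PrS[OF Suc rg] that by simp
  qed
  have "eval (Pr rf rg) xs (rec_nat (f (\<lambda>k. env xs (Suc k)))
      (\<lambda>m y. g m y (\<lambda>k. env xs (Suc k))) (env xs 0))" if "length xs = Suc n" for xs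
    using that * by (cases xs) auto
  then have P: "rfun (Suc n) (\<lambda>v. rec_nat (f (\<lambda>k. v (Suc k)))
      (\<lambda>m y. g m y (\<lambda>k. v (Suc k))) (v 0))"
    unfolding rfun_def by blast
  \<comment> \<open>\<open>Pr\<close> wants the recursion argument in front of the list. So
    \<open>b\<close> is put there by composition, followed by all projections, which pass the
    parameters on unchanged.\<close>
  let ?gs = "b # map (\<lambda>i v. v i) [0..<n]"
  have len: "length ?gs = Suc n" by simp
  have gs: "\<forall>g\<in>set ?gs. rfun n g" using b by (auto intro: rfun_var)
  have R: "rfun n (\<lambda>v. rec_nat (f (env (map (\<lambda>i. v i) [0..<n])))
      (\<lambda>m y. g m y (env (map (\<lambda>i. v i) [0..<n]))) (b v))"
    using rfun_compose[of ?gs, unfolded len, OF P gs] by (simp add: o_def)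
  have "env (map (env xs) [0..<n]) = env xs" if "length xs = n" for xs
    using that by (auto simp: env_def fun_eq_iff)
  then show ?thesis using R unfolding rfun_def by auto
qed

section \<open>Arithmetic, decidable relations and bounded quantifiers\<close>

lemma rfun_cong:
  assumes "rfun n f" and "\<And>v. f v = g v"
  shows "rfun n g"
  using assms by (simp add: rfun_def)

lemma rfun_add [rec_intros]:
  assumes "rfun n a" and "rfun n b"
  shows "rfun n (\<lambda>v. a v + b v)"
proof (rule rfun_cong)
  show "rfun n (\<lambda>v. rec_nat (a v) (\<lambda>m y. Suc y) (b v))"
    by (intro rec_intros assms) simp
  have "rec_nat x (\<lambda>m y. Suc y) k = x + k" for x k by (induction k) auto
  then show "rec_nat (a v) (\<lambda>m y. Suc y) (b v) = a v + b v" for v by blast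
qed

lemma rfun_mult [rec_intros]:
  assumes "rfun n a" and "rfun n b"
  shows "rfun n (\<lambda>v. a v * b v)"
proof (rule rfun_cong)
  have eq: "rec_nat 0 (\<lambda>m y. y + x) k = x * k" for x k :: nat by (induction k) auto
  \<comment> \<open>Below the binder \<open>a\<close> would have to be known recursive on a longer
    environment. The recursion is therefore built over plain variables, and \<open>a\<close>,
    \<open>b\<close> are substituted afterwards.\<close>
  show "rfun n (\<lambda>v. rec_nat 0 (\<lambda>m y. y + a v) (b v))"
  proof (rule rfun_cong[OF rfun_comp2[OF _ assms, of "\<lambda>x k. rec_nat 0 (\<lambda>m y. y + x) k"]])
    show "rfun 2 (\<lambda>v. rec_nat 0 (\<lambda>m y. y + v 0) (v 1))"
      by (intro rec_intros) simp_all
  qed simp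
  show "rec_nat 0 (\<lambda>m y. y + a v) (b v) = a v * b v" for v by (rule eq)
qed

lemma rfun_diff [rec_intros]:
  assumes "rfun n a" and "rfun n b"
  shows "rfun n (\<lambda>v. a v - b v)"
proof (rule rfun_comp2[OF _ assms])
  have pred: "rfun 1 (\<lambda>v. v 0 - 1)"
  proof (rule rfun_cong)
    show "rfun 1 (\<lambda>v. rec_nat 0 (\<lambda>m y. m) (v 0))"
      by (intro rec_intros) simp_all
    have "rec_nat 0 (\<lambda>m y. m) k = k - 1" for k by (cases k) auto
    then show "rec_nat 0 (\<lambda>m y. m) (v 0) = v 0 - 1" for v by blast
  qed
  show "rfun 2 (\<lambda>v. v 0 - v 1)"
  proof (rule rfun_cong)
    show "rfun 2 (\<lambda>v. rec_nat (v 0) (\<lambda>m y. y - 1) (v 1))"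
      by (intro rec_intros rfun_comp1[OF pred]) simp_all
    have "rec_nat x (\<lambda>m y. y - 1) k = x - k" for x k :: nat by (induction k) auto
    then show "rec_nat (v 0) (\<lambda>m y. y - 1) (v 1) = v 0 - v 1" for v by blast
  qed
qed

lemma rfun_power [rec_intros]:
  assumes "rfun n b"
  shows "rfun n (\<lambda>v. 2 ^ b v)"
proof (rule rfun_cong)
  show "rfun n (\<lambda>v. rec_nat 1 (\<lambda>m y. y + y) (b v))"
    by (intro rec_intros assms) simp_all
  have "rec_nat 1 (\<lambda>m y. y + y) k = (2 :: nat) ^ k" for k by (induction k) auto
  then show "rec_nat 1 (\<lambda>m y. y + y) (b v) = (2 :: nat) ^ b v" for v by blast
qed

lemma rdec_cong:
  assumes "rdec n P" and "\<And>v. P v \<longleftrightarrow> Q v"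
  shows "rdec n Q"
  using assms by (simp add: rdec_def)

lemma rfun_of_bool [rec_intros]: "rdec n P \<Longrightarrow> rfun n (\<lambda>v. of_bool (P v))"
  by (simp add: rdec_def)

lemma rdec_le [rec_intros]:
  assumes "rfun n a" and "rfun n b"
  shows "rdec n (\<lambda>v. a v \<le> b v)"
  unfolding rdec_def
  by (rule rfun_cong[of _ "\<lambda>v. 1 - (a v - b v)"], intro rec_intros assms, auto simp: of_bool_def)

lemma rdec_less [rec_intros]:
  assumes "rfun n a" and "rfun n b"
  shows "rdec n (\<lambda>v. a v < b v)"
  by (rule rdec_cong[of _ "\<lambda>v. Suc (a v) \<le> b v"], intro rec_intros assms, auto)

lemma rdec_not [rec_intros]:
  assumes "rdec n P"
  shows "rdec n (\<lambda>v. \<not> P v)"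
  unfolding rdec_def
  by (rule rfun_cong[of _ "\<lambda>v. 1 - of_bool (P v)"], intro rec_intros assms, auto)

lemma rdec_conj [rec_intros]:
  assumes "rdec n P" and "rdec n Q"
  shows "rdec n (\<lambda>v. P v \<and> Q v)"
  unfolding rdec_def
  by (rule rfun_cong[of _ "\<lambda>v. of_bool (P v) * of_bool (Q v)"], intro rec_intros assms, auto)

lemma rdec_disj [rec_intros]:
  assumes "rdec n P" and "rdec n Q"
  shows "rdec n (\<lambda>v. P v \<or> Q v)"
  by (rule rdec_cong[of _ "\<lambda>v. \<not> (\<not> P v \<and> \<not> Q v)"], intro rec_intros assms, auto)

lemma rdec_eq [rec_intros]:
  fixes a b :: "(nat \<Rightarrow> nat) \<Rightarrow> nat"
  assumes "rfun n a" and "rfun n b"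
  shows "rdec n (\<lambda>v. a v = b v)"
  by (rule rdec_cong[of _ "\<lambda>v. a v \<le> b v \<and> b v \<le> a v"], intro rec_intros assms, auto)

lemma rfun_if [rec_intros]:
  assumes "rdec n P" and "rfun n a" and "rfun n b"
  shows "rfun n (\<lambda>v. if P v then a v else b v)"
  by (rule rfun_cong[of _ "\<lambda>v. of_bool (P v) * a v + of_bool (\<not> P v) * b v"],
      intro rec_intros assms, auto)

lemma rdec_if [rec_intros]:
  assumes "rdec n P" and "rdec n Q" and "rdec n R"
  shows "rdec n (\<lambda>v. if P v then Q v else R v)"
  by (rule rdec_cong[of _ "\<lambda>v. (P v \<and> Q v) \<or> (\<not> P v \<and> R v)"], intro rec_intros assms, auto)

text \<open>Bounded quantifiers and sums bind one variable, but the recursion computing them binds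
  two. This inserts the accumulator as a dummy variable 1.\<close>

lemma rfun_shift:
  assumes "rfun (Suc n) (\<lambda>v. f (v 0) (\<lambda>k. v (Suc k)))"
  shows "rfun (Suc (Suc n)) (\<lambda>v. f (v 0) (\<lambda>k. v (Suc (Suc k))))"
proof -
  let ?gs = "(\<lambda>v. v 0) # map (\<lambda>i v. v (Suc (Suc i))) [0..<n]"
  have len: "length ?gs = Suc n" by simp
  have gs: "\<forall>g\<in>set ?gs. rfun (Suc (Suc n)) g" by (auto intro: rfun_var)
  have "rfun (Suc (Suc n)) (\<lambda>v. f (v 0) (env (map (\<lambda>i. v (Suc (Suc i))) [0..<n])))"
    using rfun_compose[of ?gs, unfolded len, OF assms gs] by (simp add: o_def)
  moreover have "env (map (\<lambda>i. env xs (Suc (Suc i))) [0..<n]) = (\<lambda>k. env xs (Suc (Suc k)))"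
    if "length xs = Suc (Suc n)" for xs
    using that by (auto simp: env_def fun_eq_iff)
  ultimately show ?thesis unfolding rfun_def by auto
qed

lemma rdec_ex_less [rec_intros]:
  assumes "rdec (Suc n) (\<lambda>v. P (v 0) (\<lambda>k. v (Suc k)))" and "rfun n b"
  shows "rdec n (\<lambda>v. \<exists>i<b v. P i v)"
proof -
  have P2: "rdec (Suc (Suc n)) (\<lambda>v. P (v 0) (\<lambda>k. v (Suc (Suc k))))"
    using rfun_shift[of n "\<lambda>i v. of_bool (P i v)"] assms(1) by (simp add: rdec_def)
  show ?thesis unfolding rdec_def
  proof (rule rfun_cong)
    show "rfun n (\<lambda>v. rec_nat 0 (\<lambda>m y. if P m v then 1 else y) (b v))"
      by (intro rec_intros assms P2) simp_all
    have "rec_nat 0 (\<lambda>m y. if P m v then 1 else y) k = of_bool (\<exists>i<k. P i v)" for v k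
      by (induction k) (auto simp: less_Suc_eq)
    then show "rec_nat 0 (\<lambda>m y. if P m v then 1 else y) (b v) = of_bool (\<exists>i<b v. P i v)" for v
      by blast
  qed
qed

lemma rdec_all_less [rec_intros]:
  assumes "rdec (Suc n) (\<lambda>v. P (v 0) (\<lambda>k. v (Suc k)))" and "rfun n b"
  shows "rdec n (\<lambda>v. \<forall>i<b v. P i v)"
  by (rule rdec_cong[of _ "\<lambda>v. \<not> (\<exists>i<b v. \<not> P i v)"], intro rec_intros assms, auto)

lemma rdec_ex_le [rec_intros]:
  assumes "rdec (Suc n) (\<lambda>v. P (v 0) (\<lambda>k. v (Suc k)))" and "rfun n b"
  shows "rdec n (\<lambda>v. \<exists>i\<le>b v. P i v)"
  by (rule rdec_cong[of _ "\<lambda>v. \<exists>i<Suc (b v). P i v"],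
      intro rec_intros assms, auto simp: less_Suc_eq_le)

lemma rdec_all_le [rec_intros]:
  assumes "rdec (Suc n) (\<lambda>v. P (v 0) (\<lambda>k. v (Suc k)))" and "rfun n b"
  shows "rdec n (\<lambda>v. \<forall>i\<le>b v. P i v)"
  by (rule rdec_cong[of _ "\<lambda>v. \<forall>i<Suc (b v). P i v"],
      intro rec_intros assms, auto simp: less_Suc_eq_le)

text \<open>\<open>Mn\<close> looks for a zero, hence the program must compute the characteristic
  function of the negation of \<open>P\<close>. Totality of that program supplies the nonzero values
  below \<open>n\<close>.\<close>

lemma eval_Mn_iff:
  assumes "\<And>k. eval r (k # xs) (of_bool (\<not> P k))"
  shows "eval (Mn r) xs n \<longleftrightarrow> P n \<and> (\<forall>m<n. \<not> P m)"
proof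
  assume "eval (Mn r) xs n"
  then show "P n \<and> (\<forall>m<n. \<not> P m)"
  proof (rule eval_MnE)
    assume 0: "eval r (n # xs) 0" and less: "\<forall>m<n. \<exists>y. eval r (m # xs) y \<and> 0 < y"
    have val: "y = of_bool (\<not> P k)" if "eval r (k # xs) y" for k y
      using eval_deterministic[OF that assms] .
    have "P n" using val[OF 0] by simp
    moreover have "\<not> P m" if "m < n" for m
      using val[of m] less that by fastforce
    ultimately show ?thesis by blast
  qed
next
  assume *: "P n \<and> (\<forall>m<n. \<not> P m)"
  show "eval (Mn r) xs n"
  proof (rule eval_Mn)
    show "eval r (n # xs) 0" using assms[of n] * by simp
    show "\<forall>m<n. \<exists>y. eval r (m # xs) y \<and> y \<noteq> 0"
    proof (intro allI impI)
      fix m assume "m < n"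
      then show "\<exists>y. eval r (m # xs) y \<and> y \<noteq> 0" using assms[of m] * by (intro exI[of _ 1]) simp
    qed
  qed
qed

lemma Least_iff: "m = (LEAST k. P k) \<longleftrightarrow> P m \<and> (\<forall>k<m. \<not> P k)" if "\<exists>k. P k" for m :: nat
  using that by (metis LeastI_ex Least_le linorder_neqE_nat not_less_Least)

lemma rfun_Least [rec_intros]:
  assumes "rdec (Suc n) (\<lambda>v. P (v 0) (\<lambda>k. v (Suc k)))" and ex: "\<And>v. \<exists>k. P k v"
  shows "rfun n (\<lambda>v. LEAST k. P k v)"
proof -
  have "rfun (Suc n) (\<lambda>v. of_bool (\<not> P (v 0) (\<lambda>k. v (Suc k))))"
    by (intro rec_intros assms)
  then obtain r where r: "\<And>xs. length xs = Suc n \<Longrightarrow>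
      eval r xs (of_bool (\<not> P (env xs 0) (\<lambda>k. env xs (Suc k))))"
    by (auto simp: rfun_def)
  have "eval (Mn r) xs (LEAST k. P k (env xs))" if "length xs = n" for xs
  proof -
    have "eval r (k # xs) (of_bool (\<not> P k (env xs)))" for k
      using r[of "k # xs"] that by simp
    from eval_Mn_iff[OF this] show ?thesis
      using Least_iff[OF ex[of "env xs"]] by blast
  qed
  then show ?thesis unfolding rfun_def by blast
qed

lemma rfun_sum [rec_intros]:
  assumes "rfun (Suc n) (\<lambda>v. f (v 0) (\<lambda>k. v (Suc k)))" and "rfun n b"
  shows "rfun n (\<lambda>v. \<Sum>i<b v. f i v)"
proof -
  note f2 = rfun_shift[OF assms(1)]
  show ?thesis
  proof (rule rfun_cong)
    show "rfun n (\<lambda>v. rec_nat 0 (\<lambda>m y. y + f m v) (b v))"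
      by (intro rec_intros assms f2) simp_all
    have "rec_nat 0 (\<lambda>m y. y + f m v) k = (\<Sum>i<k. f i v)" for v k
      by (induction k) auto
    then show "rec_nat 0 (\<lambda>m y. y + f m v) (b v) = (\<Sum>i<b v. f i v)" for v
      by blast
  qed
qed

section \<open>Division and the standard codings of sets and pairs\<close>

lemma rfun_div [rec_intros]:
  assumes "rfun n a" and "rfun n b"
  shows "rfun n (\<lambda>v. a v div b v)"
proof (rule rfun_comp2[OF _ assms])
  show "rfun 2 (\<lambda>v. v 0 div v 1)"
  proof (rule rfun_cong)
    \<comment> \<open>The disjunct \<open>y = 0\<close> keeps the search total and makes it return
      0, which is the value of \<open>x div 0\<close>.\<close>
    have ex: "\<exists>q. y = 0 \<or> x < Suc q * y" for x y :: nat
      by (cases y) (auto intro!: exI[of _ x])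
    then show "rfun 2 (\<lambda>v. LEAST q. v 1 = 0 \<or> v 0 < Suc q * v 1)"
      by (intro rec_intros) simp_all
    show "(LEAST q. v 1 = 0 \<or> v 0 < Suc q * v 1) = v 0 div v 1" for v :: "nat \<Rightarrow> nat"
    proof (rule sym, subst Least_iff[OF ex])
      have less: "y = 0 \<or> x < Suc (x div y) * y" for x y :: nat
        using dividend_less_div_times[of y x] by (cases "y = 0") (auto simp: algebra_simps)
      have ge: "\<not> (y = 0 \<or> x < Suc k * y)" if k: "k < x div y" for k x y :: nat
      proof -
        have "y \<noteq> 0" using k by (intro notI) simp
        moreover have "Suc k * y \<le> x div y * y" using k by (intro mult_le_mono1) simp
        ultimately show ?thesis using div_times_less_eq_dividend[of x y] by linarith
      qed
      show "(v 1 = 0 \<or> v 0 < Suc (v 0 div v 1) * v 1) \<and>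
        (\<forall>k<v 0 div v 1. \<not> (v 1 = 0 \<or> v 0 < Suc k * v 1))"
        using less ge by blast
    qed
  qed
qed

lemma rdec_odd [rec_intros]:
  assumes "rfun n a"
  shows "rdec n (\<lambda>v. odd (a v))"
  by (rule rdec_cong[of _ "\<lambda>v. a v \<noteq> 2 * (a v div 2)"], intro rec_intros assms) presburger

lemma rdec_even [rec_intros]:
  assumes "rfun n a"
  shows "rdec n (\<lambda>v. even (a v))"
  by (rule rdec_cong[of _ "\<lambda>v. \<not> odd (a v)"], intro rec_intros assms, auto)

lemma rdec_set_decode [rec_intros]:
  assumes "rfun n a" and "rfun n b"
  shows "rdec n (\<lambda>v. a v \<in> set_decode (b v))"
  unfolding set_decode_def mem_Collect_eq by (intro rec_intros assms)

lemma rdec_Collect [rec_intros]: "rdec n (\<lambda>v. P (a v) v) \<Longrightarrow> rdec n (\<lambda>v. a v \<in> {x. P x v})"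
  by simp

lemma rdec_empty [rec_intros]: "rdec n (\<lambda>v. a v \<in> {})"
  unfolding rdec_def empty_iff by (rule rfun_const)

lemma rfun_prod_encode [rec_intros]:
  assumes "rfun n a" and "rfun n b"
  shows "rfun n (\<lambda>v. prod_encode (a v, b v))"
  unfolding prod_encode_def triangle_def prod.case by (intro rec_intros assms)

text \<open>The components of a pair are at most its code, so decoding is a search in which the
  other component is bounded by the code.\<close>

lemma rfun_fst_decode [rec_intros]:
  assumes "rfun n a"
  shows "rfun n (\<lambda>v. fst (prod_decode (a v)))"
proof (rule rfun_comp1[OF _ assms])
  have ex: "\<exists>x. \<exists>y\<le>z. prod_encode (x, y) = z" for z
    by (metis le_prod_encode_2 prod_decode_inverse surj_pair)
  show "rfun 1 (\<lambda>v. fst (prod_decode (v 0)))"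
  proof (rule rfun_cong)
    show "rfun 1 (\<lambda>v. LEAST x. \<exists>y\<le>v 0. prod_encode (x, y) = v 0)"
      using ex by (intro rec_intros) simp_all
    show "(LEAST x. \<exists>y\<le>v 0. prod_encode (x, y) = v 0) = fst (prod_decode (v 0))" for v
      by (rule sym, subst Least_iff[OF ex])
        (metis fst_conv le_prod_encode_2 prod.collapse prod_decode_inverse
            prod_encode_inverse less_irrefl)
  qed
qed

lemma rfun_snd_decode [rec_intros]:
  assumes "rfun n a"
  shows "rfun n (\<lambda>v. snd (prod_decode (a v)))"
proof (rule rfun_comp1[OF _ assms])
  have ex: "\<exists>y. \<exists>x\<le>z. prod_encode (x, y) = z" for z
    by (metis le_prod_encode_1 prod_decode_inverse surj_pair)
  show "rfun 1 (\<lambda>v. snd (prod_decode (v 0)))"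
  proof (rule rfun_cong)
    show "rfun 1 (\<lambda>v. LEAST y. \<exists>x\<le>v 0. prod_encode (x, y) = v 0)"
      using ex by (intro rec_intros) simp_all
    show "(LEAST y. \<exists>x\<le>v 0. prod_encode (x, y) = v 0) = snd (prod_decode (v 0))" for v
      by (rule sym, subst Least_iff[OF ex])
        (metis snd_conv le_prod_encode_1 prod.collapse prod_decode_inverse
            prod_encode_inverse less_irrefl)
  qed
qed

text \<open>The source of all partial functions below: search without any promise of success for a
  witness \<open>w\<close>, then compute from it. Only the least witness counts, so users show that
  all witnesses give the same value.\<close>

lemma search_recf:
  assumes "rdec 2 (\<lambda>v. D (v 0) (v 1))" and "rfun 2 (\<lambda>v. f (v 0) (v 1))"
  obtains r where "\<And>z n. eval r [z] n \<longleftrightarrow> (\<exists>w. D z w) \<and> n = f z (LEAST w. D z w)"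
proof -
  have "rfun 2 (\<lambda>v. of_bool (\<not> D (v 1) (v 0)))"
    by (intro rec_intros rdec_comp2[OF assms(1)]) simp_all
  then obtain d where "\<forall>xs. length xs = 2 \<longrightarrow> eval d xs (of_bool (\<not> D (env xs 1) (env xs 0)))"
    unfolding rfun_def by blast
  then have d: "eval d [w, z] (of_bool (\<not> D z w))" for w z
    by (auto dest: spec[of _ "[w, z]"])
  from assms(2) obtain g where "\<forall>xs. length xs = 2 \<longrightarrow> eval g xs (f (env xs 0) (env xs 1))"
    unfolding rfun_def by blast
  then have g: "eval g [z, w] (f z w)" for w z
    by (auto dest: spec[of _ "[z, w]"])
  have Mn: "eval (Mn d) [z] w \<longleftrightarrow> (\<exists>w. D z w) \<and> w = (LEAST w. D z w)" for z w
    using eval_Mn_iff[OF d] Least_iff by metis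
  have Proj: "eval (Proj 0) [z] y \<longleftrightarrow> y = z" for z y
    using eval_Proj[of 0 "[z]"] eval_deterministic by fastforce
  have "eval (Cn g [Proj 0, Mn d]) [z] n \<longleftrightarrow> (\<exists>w. D z w) \<and> n = f z (LEAST w. D z w)" for z n
  proof
    assume "eval (Cn g [Proj 0, Mn d]) [z] n"
    then obtain ys where ys: "list_all2 (\<lambda>g y. eval g [z] y) [Proj 0, Mn d] ys" "eval g ys n"
      by (rule eval_CnE)
    then show "(\<exists>w. D z w) \<and> n = f z (LEAST w. D z w)"
      using g eval_deterministic by (auto simp: list_all2_Cons1 Mn Proj)
  next
    assume "(\<exists>w. D z w) \<and> n = f z (LEAST w. D z w)"
    then show "eval (Cn g [Proj 0, Mn d]) [z] n"
      using g by (auto intro!: eval_Cn[where ys = "[z, LEAST w. D z w]"] simp: Mn Proj)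
  qed
  then show ?thesis using that by blast
qed

lemma ce_ex:
  assumes "rdec 2 (\<lambda>v. D (v 0) (v 1))"
  shows "ce {z. \<exists>w. D z w}"
proof -
  obtain r where "\<And>z n. eval r [z] n \<longleftrightarrow> (\<exists>w. D z w) \<and> n = 0"
    using search_recf[OF assms, of "\<lambda>_ _. 0"] rfun_const by auto
  then show ?thesis unfolding ce_def by (auto intro!: exI[of _ r])
qed

text \<open>Every stage is finite because \<open>S (Suc s)\<close> lies below \<open>Suc s\<close>.
  It can thus be stored as one number by \<open>set_encode\<close>, and the recursion on sets
  becomes primitive recursion on codes. Both \<open>derived\<close> and \<open>stage0\<close> have
  this form.\<close>

lemma rdec_set_rec:
  assumes P: "rdec 3 (\<lambda>v. P (v 0) (v 1) (set_decode (v 2)))"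
    and S: "S 0 = {}" "\<And>s. S (Suc s) = {q. q \<le> s \<and> P q s (S s)}"
    and "rfun n a" and "rfun n b"
  shows "rdec n (\<lambda>v. a v \<in> S (b v))"
proof (rule rdec_comp2[OF _ assms(4,5)])
  define h where "h = rec_nat 0 (\<lambda>s h. \<Sum>q<Suc s. if P q s (set_decode h) then 2 ^ q else 0)"
  have "rfun 1 (\<lambda>v. h (v 0))"
    unfolding h_def by (intro rec_intros rdec_comp3[OF P]) simp_all
  note h = rfun_comp1[OF this]
  have fin: "finite (S s)" for s by (cases s) (simp_all add: S)
  have "set_encode (S s) = h s" for s
  proof (induction s)
    case 0
    show ?case by (simp add: h_def S)
  next
    case (Suc s)
    have "set_encode (S (Suc s)) = (\<Sum>q\<in>{q\<in>{..<Suc s}. P q s (S s)}. 2 ^ q)"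
      by (simp add: S set_encode_def less_Suc_eq_le)
    also have "\<dots> = (\<Sum>q<Suc s. if P q s (S s) then 2 ^ q else 0)"
      by (rule sum.inter_filter) simp
    also have "S s = set_decode (h s)"
      using Suc fin set_encode_inverse by metis
    finally show ?case by (simp add: h_def)
  qed
  then have "S s = set_decode (h s)" for s using fin set_encode_inverse by metis
  then show "rdec 2 (\<lambda>v. v 0 \<in> S (v 1))"
    by (simp only:) (intro rec_intros h, simp_all)
qed

section \<open>A universal recursive function\<close>

abbreviation pr :: "nat \<Rightarrow> nat \<Rightarrow> nat" where "pr a b \<equiv> prod_encode (a, b)"
abbreviation p1 :: "nat \<Rightarrow> nat" where "p1 z \<equiv> fst (prod_decode z)"
abbreviation p2 :: "nat \<Rightarrow> nat" where "p2 z \<equiv> snd (prod_decode z)"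

primrec recf_code :: "recf \<Rightarrow> nat" where
  "recf_code Zr = pr 0 0"
| "recf_code Sc = pr 1 0"
| "recf_code (Proj i) = pr 2 i"
| "recf_code (Cn f gs) = pr 3 (pr (recf_code f) (list_encode (map recf_code gs)))"
| "recf_code (Pr f g) = pr 4 (pr (recf_code f) (recf_code g))"
| "recf_code (Mn f) = pr 5 (recf_code f)"

text \<open>One inference step for facts ``program \<^term>\<open>c\<close> maps the argument list \<^term>\<open>x\<close> to
  \<^term>\<open>y\<close>'', all of them coded. The tag 6 does not belong to a program: it marks a list of
  programs, whose value is the list of their values.\<close>

definition justified :: "nat \<Rightarrow> nat set \<Rightarrow> nat \<Rightarrow> nat \<Rightarrow> nat \<Rightarrow> bool" where
  "justified s D c x y \<longleftrightarrow>
     p1 c = 0 \<and> y = 0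
   \<or> p1 c = 1 \<and> x \<noteq> 0 \<and> y = Suc (p1 (x - 1))
   \<or> p1 c = 2 \<and> x \<noteq> 0 \<and> (if p2 c = 0 then y = p1 (x - 1)
       else pr (pr 2 (p2 c - 1)) (pr (p2 (x - 1)) y) \<in> D)
   \<or> p1 c = 3 \<and> (\<exists>ys<s. pr (pr 6 (p2 (p2 c))) (pr x ys) \<in> D \<and> pr (p1 (p2 c)) (pr ys y) \<in> D)
   \<or> p1 c = 4 \<and> x \<noteq> 0 \<and> (if p1 (x - 1) = 0 then pr (p1 (p2 c)) (pr (p2 (x - 1)) y) \<in> D
       else \<exists>z<s. pr c (pr (Suc (pr (p1 (x - 1) - 1) (p2 (x - 1)))) z) \<in> D \<and>
         pr (p2 (p2 c))
           (pr (Suc (pr (p1 (x - 1) - 1) (Suc (pr z (p2 (x - 1)))))) y) \<in> D)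
   \<or> p1 c = 5 \<and> pr (p2 c) (pr (Suc (pr y x)) 0) \<in> D \<and>
       (\<forall>m<y. \<exists>z<s. z \<noteq> 0 \<and> pr (p2 c) (pr (Suc (pr m x)) z) \<in> D)
   \<or> p1 c = 6 \<and> (if p2 c = 0 then y = 0 else y \<noteq> 0 \<and>
       pr (p1 (p2 c - 1)) (pr x (p1 (y - 1))) \<in> D \<and>
       pr (pr 6 (p2 (p2 c - 1))) (pr x (p2 (y - 1))) \<in> D)"

text \<open>The bound \<open>q \<le> s\<close> keeps stages finite, as \<open>rdec_set_rec\<close>
  demands. Older facts are not carried over by hand; they persist because \<open>justified\<close>
  is monotone.\<close>

primrec derived :: "nat \<Rightarrow> nat set" where
  "derived 0 = {}"
| "derived (Suc s) =
     {q. q \<le> s \<and> justified s (derived s) (p1 q) (p1 (p2 q)) (p2 (p2 q))}"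

lemma rdec_derived [rec_intros]:
  assumes "rfun n a" and "rfun n b"
  shows "rdec n (\<lambda>v. a v \<in> derived (b v))"
proof (rule rdec_set_rec[OF _ _ _ assms])
  show "rdec 3 (\<lambda>v. justified (v 1) (set_decode (v 2)) (p1 (v 0)) (p1 (p2 (v 0))) (p2 (p2 (v 0))))"
    unfolding justified_def by (intro rec_intros) simp_all
qed simp_all

lemma justified_mono: "justified s D c x y \<Longrightarrow> s \<le> t \<Longrightarrow> D \<subseteq> D' \<Longrightarrow> justified t D' c x y"
  unfolding justified_def
  by (elim disjE)
    (auto split: if_splits dest: order_less_le_trans; meson subsetD order_less_le_trans)+

lemma derived_mono_Suc: "derived s \<subseteq> derived (Suc s)"
proof (induction s)
  case (Suc s)
  then show ?case by (auto intro: justified_mono)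
qed simp

lemma derived_mono: "s \<le> t \<Longrightarrow> derived s \<subseteq> derived t"
  using lift_Suc_mono_le[of derived] derived_mono_Suc by blast

lemma derived_less: "q \<in> derived s \<Longrightarrow> q < s"
  by (cases s) auto

text \<open>This makes the bounds \<open>< s\<close> on intermediate values in
  \<open>justified\<close> harmless: a value occurring in a fact of the stage satisfies them
  automatically.\<close>

lemma derived_fact_less:
  assumes "pr c (pr x y) \<in> derived s"
  shows "c < s" and "x < s" and "y < s"
  using derived_less[OF assms] le_prod_encode_1[of c "pr x y"] le_prod_encode_2[of "pr x y" c]
    le_prod_encode_1[of x y] le_prod_encode_2[of y x] by linarith+

text \<open>A justified conclusion may have a code above the current stage. Waiting until the stage
  reaches that code costs nothing, by monotonicity.\<close>

lemma derived_intro: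
  assumes "justified s (derived s) c x y"
  shows "\<exists>s. pr c (pr x y) \<in> derived s"
proof -
  let ?t = "max s (pr c (pr x y))"
  have "justified ?t (derived ?t) c x y"
    using assms by (rule justified_mono) (simp_all add: derived_mono)
  then have "pr c (pr x y) \<in> derived (Suc ?t)" by simp
  then show ?thesis by blast
qed

text \<open>Induction on the stage, for programs and tag-6 lists together, since the rule for
  \<open>Cn\<close> appeals to a list and the rule for lists to a program.\<close>

lemma derived_sound:
  "pr c (pr x y) \<in> derived s \<Longrightarrow>
    (\<forall>r xs. c = recf_code r \<and> x = list_encode xs \<longrightarrow> eval r xs y) \<and>
    (\<forall>gs xs. c = pr 6 (list_encode (map recf_code gs)) \<and> x = list_encode xs \<longrightarrow>
      (\<exists>ys. y = list_encode ys \<and> list_all2 (\<lambda>g y. eval g xs y) gs ys))"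
proof (induction s arbitrary: c x y)
  case 0
  then show ?case by simp
next
  case (Suc s)
  note prog = Suc.IH[THEN conjunct1, rule_format, OF _ conjI, OF _ refl refl]
  note progs = Suc.IH[THEN conjunct2, rule_format, OF _ conjI, OF _ refl refl]
  have J: "justified s (derived s) c x y" using Suc.prems by simp
  have "eval r xs y" if c: "c = recf_code r" and x: "x = list_encode xs" for r xs
  proof (cases r)
    case Zr
    then show ?thesis using J c by (simp add: justified_def eval_Zr)
  next
    case Sc
    then show ?thesis using J c x
      by (cases xs) (auto simp: justified_def intro: eval_Sc)
  next
    case (Proj i)
    then obtain a l where xs: "xs = a # l"
      using J c x by (cases xs) (auto simp: justified_def)
    show ?thesis
    proof (cases i)
      case 0
      then show ?thesis using J c x Proj xs eval_Proj[of 0 xs]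
        by (auto simp: justified_def)
    next
      case (Suc j)
      then have "pr (recf_code (Proj j)) (pr (list_encode l) y) \<in> derived s"
        using J c x Proj xs by (auto simp: justified_def)
      then have "eval (Proj j) l y" by (rule prog)
      then show ?thesis using Suc Proj xs
        by (auto elim!: eval_ProjE intro: eval_Proj[of "Suc j" "a # l", simplified])
    qed
  next
    case (Cn f gs)
    then obtain z where "pr (pr 6 (list_encode (map recf_code gs))) (pr (list_encode xs) z) \<in> derived s"
      and z: "pr (recf_code f) (pr z y) \<in> derived s"
      using J c x by (auto simp: justified_def)
    then obtain ys where "z = list_encode ys" "list_all2 (\<lambda>g y. eval g xs y) gs ys"
      using progs by blast
    then show ?thesis using z prog Cn by (auto intro: eval_Cn)
  next
    case (Pr f g)
    then obtain k l where xs: "xs = k # l"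
      using J c x by (cases xs) (auto simp: justified_def)
    show ?thesis
    proof (cases k)
      case 0
      then have "pr (recf_code f) (pr (list_encode l) y) \<in> derived s"
        using J c x Pr xs by (auto simp: justified_def)
      then show ?thesis using 0 Pr xs prog by (auto intro: eval_Pr0)
    next
      case (Suc m)
      then obtain z where "pr (recf_code r) (pr (list_encode (m # l)) z) \<in> derived s"
        and "pr (recf_code g) (pr (list_encode (m # z # l)) y) \<in> derived s"
        using J c x Pr xs by (auto simp: justified_def)
      then have "eval r (m # l) z" "eval g (m # z # l) y" using prog by blast+
      then show ?thesis using Suc Pr xs by (auto intro: eval_PrS)
    qed
  next
    case (Mn f)
    then have "pr (recf_code f) (pr (list_encode (y # xs)) 0) \<in> derived s"
      and "\<forall>m<y. \<exists>z. z \<noteq> 0 \<and> pr (recf_code f) (pr (list_encode (m # xs)) z) \<in> derived s"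
      using J c x by (auto simp: justified_def)
    then have "eval f (y # xs) 0" and "\<forall>m<y. \<exists>z. eval f (m # xs) z \<and> z \<noteq> 0"
      using prog by blast+
    then show ?thesis using Mn by (auto intro: eval_Mn)
  qed
  moreover have "\<exists>ys. y = list_encode ys \<and> list_all2 (\<lambda>g y. eval g xs y) gs ys"
    if c: "c = pr 6 (list_encode (map recf_code gs))" and x: "x = list_encode xs" for gs xs
  proof (cases gs)
    case Nil
    then show ?thesis using J c by (auto simp: justified_def intro!: exI[of _ "[]"])
  next
    case (Cons g gs')
    then have y: "y \<noteq> 0" and g: "pr (recf_code g) (pr (list_encode xs) (p1 (y - 1))) \<in> derived s"
      and gs': "pr (pr 6 (list_encode (map recf_code gs')))
        (pr (list_encode xs) (p2 (y - 1))) \<in> derived s"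
      using J c x by (auto simp: justified_def)
    obtain ys where ys: "p2 (y - 1) = list_encode ys" "list_all2 (\<lambda>g y. eval g xs y) gs' ys"
      using progs[OF gs'] by blast
    have "y = list_encode (p1 (y - 1) # ys)" using y by (simp flip: ys(1))
    then show ?thesis using ys(2) prog[OF g] Cons by blast
  qed
  ultimately show ?case by blast
qed

text \<open>Each premise of an evaluation is derived at some stage of its own; monotonicity brings
  the finitely many premises to a common stage, where the conclusion is justified.\<close>

lemma derived_complete: "eval r xs y \<Longrightarrow> \<exists>s. pr (recf_code r) (pr (list_encode xs) y) \<in> derived s"
proof (induction rule: eval.induct)
  case (eval_Zr xs)
  show ?case by (rule derived_intro) (simp add: justified_def)
next
  case (eval_Sc x xs)
  show ?case by (rule derived_intro) (simp add: justified_def)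
next
  case (eval_Proj i xs)
  then show ?case
  proof (induction i arbitrary: xs)
    case 0
    then show ?case by (cases xs) (auto simp: justified_def intro!: derived_intro)
  next
    case (Suc i)
    then obtain a l where xs: "xs = a # l" by (cases xs) auto
    with Suc obtain s where "pr (recf_code (Proj i)) (pr (list_encode l) (l ! i)) \<in> derived s"
      by fastforce
    then show ?case
      by (intro derived_intro[of s]) (simp add: justified_def xs)
  qed
next
  case (eval_Cn xs gs ys f z)
  from eval_Cn.IH(1)
  \<comment> \<open>The arguments of \<open>Cn\<close> are collected into one tag-6 fact by a
    separate induction along the list.\<close>
  have "\<exists>s. pr (pr 6 (list_encode (map recf_code gs))) (pr (list_encode xs) (list_encode ys))
      \<in> derived s"
  proof (induction rule: list_all2_induct)
    case Nil
    show ?case by (rule derived_intro) (simp add: justified_def)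
  next
    case (Cons g gs y ys)
    then obtain s t where s: "pr (recf_code g) (pr (list_encode xs) y) \<in> derived s"
      and t: "pr (pr 6 (list_encode (map recf_code gs))) (pr (list_encode xs) (list_encode ys))
      \<in> derived t"
      by blast
    have "derived s \<subseteq> derived (max s t)" "derived t \<subseteq> derived (max s t)"
      by (simp_all add: derived_mono)
    with s t show ?case
      by (intro derived_intro[of "max s t"]) (auto simp: justified_def)
  qed
  with eval_Cn.IH(2) obtain s t
    where s: "pr (pr 6 (list_encode (map recf_code gs))) (pr (list_encode xs) (list_encode ys))
      \<in> derived s"
    and t: "pr (recf_code f) (pr (list_encode ys) z) \<in> derived t"
    by blast
  have "derived s \<subseteq> derived (max s t)" "derived t \<subseteq> derived (max s t)"
    by (simp_all add: derived_mono)
  then have "list_encode ys < max s t" using derived_fact_less(3) s by fastforce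
  with s t \<open>derived s \<subseteq> _\<close> \<open>derived t \<subseteq> _\<close> show ?case
    by (intro derived_intro[of "max s t"]) (auto simp: justified_def intro!: exI[of _ "list_encode ys"])
next
  case (eval_Pr0 f xs y g)
  then obtain s where "pr (recf_code f) (pr (list_encode xs) y) \<in> derived s" by blast
  then show ?case by (intro derived_intro[of s]) (simp add: justified_def)
next
  case (eval_PrS f g n xs y z)
  then obtain s t where s: "pr (recf_code (Pr f g)) (pr (list_encode (n # xs)) y) \<in> derived s"
    and t: "pr (recf_code g) (pr (list_encode (n # y # xs)) z) \<in> derived t"
    by blast
  have sub: "derived s \<subseteq> derived (max s t)" "derived t \<subseteq> derived (max s t)"
    by (simp_all add: derived_mono)
  then have "y < max s t" using derived_fact_less(3) s by fastforce
  with s t sub show ?case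
    by (intro derived_intro[of "max s t"]) (auto simp: justified_def intro!: exI[of _ y])
next
  case (eval_Mn f n xs)
  then obtain s where s: "pr (recf_code f) (pr (list_encode (n # xs)) 0) \<in> derived s" by blast
  have "\<forall>m<n. \<exists>t z. z \<noteq> 0 \<and> pr (recf_code f) (pr (list_encode (m # xs)) z) \<in> derived t"
    using eval_Mn.IH(2) by blast
  then obtain t where t: "\<forall>m<n. \<exists>z. z \<noteq> 0 \<and>
      pr (recf_code f) (pr (list_encode (m # xs)) z) \<in> derived (t m)"
    by metis
  let ?s = "Max (insert s (t ` {..<n}))"
  have sub: "derived s \<subseteq> derived ?s" "\<And>m. m < n \<Longrightarrow> derived (t m) \<subseteq> derived ?s"
    by (intro derived_mono Max_ge; simp)+
  have "\<forall>m<n. \<exists>z<?s. z \<noteq> 0 \<and> pr (recf_code f) (pr (list_encode (m # xs)) z) \<in> derived ?s"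
    using t sub(2) derived_fact_less(3) by (meson subsetD)
  with s sub(1) show ?case
    by (intro derived_intro[of ?s]) (auto simp: justified_def)
qed

text \<open>\<open>Suc (pr x 0)\<close> is \<open>list_encode [x]\<close>, the coded one-element
  argument list.\<close>

definition halts_in :: "nat \<Rightarrow> nat \<Rightarrow> nat \<Rightarrow> nat \<Rightarrow> bool" where
  "halts_in s c x y \<longleftrightarrow> pr c (pr (Suc (pr x 0)) y) \<in> derived s"

lemma eval_iff_halts_in: "eval r [x] y \<longleftrightarrow> (\<exists>s. halts_in s (recf_code r) x y)"
proof -
  have "list_encode [x] = Suc (pr x 0)" by simp
  then show ?thesis unfolding halts_in_def
    using derived_complete[of r "[x]" y] derived_sound[of "recf_code r" "Suc (pr x 0)" y] by metis
qed

lemma halts_in_mono: "halts_in s c x y \<Longrightarrow> s \<le> t \<Longrightarrow> halts_in t c x y"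
  unfolding halts_in_def using derived_mono by blast

lemma halts_in_less:
  assumes "halts_in s c x y"
  shows "y < s"
  using assms derived_fact_less(3) unfolding halts_in_def by blast

lemma rdec_halts_in [rec_intros]:
  assumes "rfun n a" and "rfun n b" and "rfun n c" and "rfun n d"
  shows "rdec n (\<lambda>v. halts_in (a v) (b v) (c v) (d v))"
  unfolding halts_in_def by (intro rec_intros assms)

section \<open>Machines on strings and plain complexity\<close>

lemma Suc_str_code: "Suc (str_code w) = foldl (\<lambda>acc b. 2 * acc + (if b then 1 else 0)) 1 w"
proof -
  have "1 \<le> foldl (\<lambda>acc b. 2 * acc + (if b then 1 else 0 :: nat)) 1 w"
    by (induction w rule: rev_induct) auto
  then show ?thesis unfolding str_code_def by simp
qed

lemma str_code_Nil [simp]: "str_code [] = 0"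
  by (simp add: str_code_def)

lemma str_code_snoc: "str_code (w @ [b]) = 2 * str_code w + (if b then 2 else 1)"
proof -
  have "Suc (str_code (w @ [b])) = 2 * Suc (str_code w) + (if b then 1 else 0)"
    unfolding Suc_str_code by simp
  then show ?thesis by simp
qed

text \<open>Appending \<open>True\<close> sends \<open>n\<close> to \<open>2 * n + 2\<close>, which
  doubles \<open>n + 2\<close>; appending \<open>False\<close> to \<open>w\<close> makes
  \<open>n + 2\<close> the odd number \<open>2 * str_code w + 3\<close>.\<close>

lemma str_code_replicate:
  "str_code (w @ False # replicate e True) + 2 = 2 ^ e * (2 * str_code w + 3)"
proof (induction e)
  case 0
  show ?case by (simp add: str_code_snoc)
next
  case (Suc e)
  have "w @ False # replicate (Suc e) True = (w @ False # replicate e True) @ [True]"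
    by (simp add: replicate_append_same)
  then show ?case using Suc by (simp only: str_code_snoc) simp
qed

lemma inj_str_code: "inj str_code"
proof (rule injI)
  show "str_code v = str_code w \<Longrightarrow> v = w" for v w
  proof (induction v arbitrary: w rule: rev_induct)
    case Nil
    then show ?case by (cases w rule: rev_exhaust) (auto simp: str_code_snoc split: if_splits)
  next
    case (snoc b v)
    then obtain c u where w: "w = u @ [c]"
      by (cases w rule: rev_exhaust) (auto simp: str_code_snoc split: if_splits)
    have eq: "2 * str_code v + (if b then 2 else 1) = 2 * str_code u + (if c then 2 else 1)"
      using snoc.prems by (simp add: w str_code_snoc)
    then have "b = c" by (cases b; cases c; simp; presburger)
    with eq snoc.IH[of u] show ?case by (simp add: w)
  qed
qed

lemma surj_str_code: "\<exists>w. str_code w = n"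
proof (induction n rule: less_induct)
  case (less n)
  show ?case
  proof (cases "n = 0")
    case True
    then show ?thesis by (auto intro: exI[of _ "[]"])
  next
    case False
    then have "(n - 1) div 2 < n" by simp
    from less[OF this] obtain w where w: "str_code w = (n - 1) div 2" by blast
    have "str_code (w @ [even n]) = n"
      using False by (simp add: str_code_snoc w) presburger
    then show ?thesis by blast
  qed
qed

lemma str_code_eq_iff [simp]: "str_code v = str_code w \<longleftrightarrow> v = w"
  using inj_str_code by (auto dest: injD)

text \<open>Turns a quantifier over short programs into a bounded quantifier over numbers, as used
  in \<open>Cstage\<close>.\<close>

lemma str_code_length: "length w \<le> k \<longleftrightarrow> Suc (str_code w) < 2 ^ Suc k"
proof -
  have *: "2 ^ length w \<le> Suc (str_code w) \<and> Suc (str_code w) < 2 ^ Suc (length w)"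
    by (induction w rule: rev_induct) (auto simp: str_code_snoc)
  show ?thesis
  proof
    assume "length w \<le> k"
    then have "(2 :: nat) ^ Suc (length w) \<le> 2 ^ Suc k" by (intro power_increasing) auto
    with * show "Suc (str_code w) < 2 ^ Suc k" by linarith
  next
    assume "Suc (str_code w) < 2 ^ Suc k"
    with * have "(2 :: nat) ^ length w < 2 ^ Suc k" by linarith
    then show "length w \<le> k" by (simp del: power_Suc)
  qed
qed

definition machine :: "recf \<Rightarrow> bool list \<Rightarrow> bool list option" where
  "machine r p = (if \<exists>y. eval r [str_code p] (str_code y)
     then Some (THE y. eval r [str_code p] (str_code y)) else None)"

lemma machine_iff: "machine r p = Some y \<longleftrightarrow> eval r [str_code p] (str_code y)"
proof
  assume "machine r p = Some y"
  then have y: "\<exists>y. eval r [str_code p] (str_code y)" "y = (THE y. eval r [str_code p] (str_code y))"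
    by (auto simp: machine_def split: if_splits)
  from y(1) have "\<exists>!y. eval r [str_code p] (str_code y)"
    using eval_deterministic str_code_eq_iff by blast
  from theI'[OF this] show "eval r [str_code p] (str_code y)" by (simp add: y(2))
next
  assume y: "eval r [str_code p] (str_code y)"
  then have "(THE y. eval r [str_code p] (str_code y)) = y"
    using eval_deterministic str_code_eq_iff by blast
  then show "machine r p = Some y" using y by (auto simp: machine_def)
qed

lemma partial_computable_iff: "partial_computable M \<longleftrightarrow> (\<exists>r. M = machine r)"
proof
  assume "partial_computable M"
  then obtain r where r: "\<forall>p n. eval r [str_code p] n \<longleftrightarrow> (\<exists>y. M p = Some y \<and> n = str_code y)"
    unfolding partial_computable_def by blast
  have "M p = Some y \<longleftrightarrow> machine r p = Some y" for p y
    using r by (auto simp: machine_iff)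
  then have "M p = machine r p" for p
    by (metis option.exhaust)
  then show "\<exists>r. M = machine r" by blast
next
  assume "\<exists>r. M = machine r"
  then obtain r where "M = machine r" ..
  then show "partial_computable M" unfolding partial_computable_def
    by (intro exI[of _ r]) (metis machine_iff surj_str_code)
qed

lemma KC_le: "M p = Some x \<Longrightarrow> KC M x \<le> enat (length p)"
  unfolding KC_def by (rule INF_lower) simp

lemma KC_attained:
  assumes "KC M x = enat k"
  obtains p where "M p = Some x" and "length p = k"
proof -
  let ?L = "(\<lambda>p. enat (length p)) ` {p. M p = Some x}"
  have "?L \<noteq> {}" using assms by (auto simp: KC_def Inf_enat_def split: if_splits)
  then have "Inf ?L \<in> ?L" 
    by (metis Inf_enat_def LeastI ex_in_conv)
  then have "enat k \<in> ?L" using assms by (simp add: KC_def)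
  then show ?thesis using that by auto
qed

lemma KC_le_transfer:
  assumes "\<And>p. M p = Some x \<Longrightarrow> \<exists>q. N q = Some y \<and> length q \<le> length p + c"
  shows "KC N y \<le> KC M x + enat c"
proof (cases "KC M x")
  case (enat k)
  then obtain p where "M p = Some x" "length p = k" by (rule KC_attained)
  with assms obtain q where "N q = Some y" "length q \<le> k + c" by blast
  then show ?thesis using enat KC_le[of N q y] by (simp add: order_trans)
qed simp

text \<open>Since \<open>2 * a + 3\<close> is odd, the power of 2 can be read off. For the optimal
  machine the exponent is the program and the odd part its input.\<close>

lemma two_power_odd_unique:
  assumes "2 ^ d * (2 * a + 3) = 2 ^ e * (2 * b + (3 :: nat))"
  shows "e = d \<and> b = a"
  using assms
proof (induction d arbitrary: e)
  case 0
  show ?case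
  proof (cases e)
    case (Suc e')
    have "odd (2 ^ e * (2 * b + 3))" by (subst 0[symmetric]) simp
    then show ?thesis by (simp add: Suc)
  qed (use 0 in simp)
next
  case (Suc d)
  show ?case
  proof (cases e)
    case 0
    have "even (2 ^ e * (2 * b + 3))" by (subst Suc.prems[symmetric]) simp
    then show ?thesis by (simp add: 0)
  next
    case (Suc e')
    with Suc.prems Suc.IH[of e'] show ?thesis by simp
  qed
qed

text \<open>On input \<open>p01\<^sup>e\<close> the optimal machine runs program \<open>e\<close> on \<open>p\<close>. Storing the program in a
  suffix lets \<open>str_code_replicate\<close> decode the input arithmetically.\<close>

lemma optimal_machine_exists: "\<exists>U. optimal_machine U"
proof -
  \<comment> \<open>A witness \<open>w\<close> codes the quadruple of program, input, output and
    halting stage.\<close>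
  define D where "D z w \<longleftrightarrow> z + 2 = 2 ^ p1 w * (2 * p1 (p2 w) + 3) \<and>
      halts_in (p2 (p2 (p2 w))) (p1 w) (p1 (p2 w)) (p1 (p2 (p2 w)))" for z w
  have "rdec 2 (\<lambda>v. D (v 0) (v 1))" "rfun 2 (\<lambda>v. p1 (p2 (p2 (v 1))))"
    unfolding D_def by (intro rec_intros; simp)+
  then obtain u where u: "\<And>z n. eval u [z] n \<longleftrightarrow>
      (\<exists>w. D z w) \<and> n = p1 (p2 (p2 (LEAST w. D z w)))"
    using search_recf[of D "\<lambda>z w. p1 (p2 (p2 w))"] by blast
  have run: "machine u (p @ False # replicate (recf_code r) True) = Some y"
    if y: "machine r p = Some y" for r p y
  proof -
    let ?z = "str_code (p @ False # replicate (recf_code r) True)"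
    obtain s where s: "halts_in s (recf_code r) (str_code p) (str_code y)"
      using y eval_iff_halts_in machine_iff by blast
    have "D ?z (pr (recf_code r) (pr (str_code p) (pr (str_code y) s)))"
      unfolding D_def using s str_code_replicate by simp
    then have ex: "\<exists>w. D ?z w" by blast
    have "p1 (p2 (p2 w)) = str_code y" if "D ?z w" for w
    proof -
      have "2 ^ recf_code r * (2 * str_code p + 3) = 2 ^ p1 w * (2 * p1 (p2 w) + 3)"
        using that unfolding D_def str_code_replicate by simp
      then have "p1 w = recf_code r \<and> p1 (p2 w) = str_code p"
        by (rule two_power_odd_unique)
      with that have "eval r [str_code p] (p1 (p2 (p2 w)))"
        unfolding D_def eval_iff_halts_in by auto
      then show ?thesis using y eval_deterministic machine_iff by blast
    qed
    then show ?thesis using LeastI_ex[OF ex] ex by (simp add: machine_iff u)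
  qed
  have "\<exists>c. \<forall>x. KC (machine u) x \<le> KC (machine r) x + enat c" for r
    \<comment> \<open>The constant is the length of the suffix that names program
      \<open>recf_code r\<close>.\<close>
    by (intro exI[of _ "Suc (recf_code r)"] allI KC_le_transfer) (use run in fastforce)
  then have "optimal_machine (machine u)"
    unfolding optimal_machine_def by (auto simp: partial_computable_iff)
  then show ?thesis by blast
qed

lemma optimal_U_opt: "optimal_machine U_opt"
  unfolding U_opt_def using optimal_machine_exists by (rule someI_ex)

definition u_recf :: recf where
  "u_recf = (SOME r. U_opt = machine r)"

lemma U_opt_eq: "U_opt = machine u_recf"
  using someI_ex[of "\<lambda>r. U_opt = machine r"] optimal_U_opt
  unfolding u_recf_def optimal_machine_def partial_computable_iff by blast

lemma C_finite: "\<exists>k. C x = enat k"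
proof -
  have id: "machine (Proj 0) p = Some p" for p
    using eval_Proj[of 0 "[str_code p]"] by (simp add: machine_iff)
  obtain c where c: "KC U_opt x \<le> KC (machine (Proj 0)) x + enat c"
    using optimal_U_opt unfolding optimal_machine_def partial_computable_iff by blast
  have "C x \<le> enat (length x) + enat c"
    unfolding C_def using c KC_le[OF id] by (meson add_right_mono order_trans)
  then show ?thesis by (cases "C x") auto
qed

definition plainC :: "bool list \<Rightarrow> nat" where
  "plainC x = the_enat (C x)"

lemma C_eq: "C x = enat (plainC x)"
  using C_finite[of x] by (auto simp: plainC_def)

lemma leqC_iff: "Y \<le>\<^sub>C Z \<longleftrightarrow> (\<exists>c. \<forall>n. plainC (restr Y n) \<le> plainC (restr Z n) + c)"
  by (simp add: leqC_def C_eq)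

text \<open>All upper bounds on complexity are obtained here: \<open>y\<close> costs no more than
  \<open>x\<close>, up to a constant, if a fixed search started from \<open>x\<close> finds
  \<open>y\<close> whichever witness it meets. The search is run on the output of the optimal
  machine, so descriptions of \<open>x\<close> describe \<open>y\<close>.\<close>

lemma plainC_le_search:
  assumes "rdec 2 (\<lambda>v. D (v 0) (v 1))" and "rfun 2 (\<lambda>v. f (v 0) (v 1))"
  shows "\<exists>c. \<forall>x y. (\<exists>w. D (str_code x) w) \<longrightarrow>
    (\<forall>w. D (str_code x) w \<longrightarrow> f (str_code x) w = str_code y) \<longrightarrow> plainC y \<le> plainC x + c"
proof -
  obtain r where r: "\<And>z n. eval r [z] n \<longleftrightarrow> (\<exists>w. D z w) \<and> n = f z (LEAST w. D z w)"
    using search_recf[OF assms] by blast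
  let ?M = "machine (Cn r [u_recf])"
  obtain c where c: "\<And>y. KC U_opt y \<le> KC ?M y + enat c"
    using optimal_U_opt unfolding optimal_machine_def partial_computable_iff by blast
  have "plainC y \<le> plainC x + c"
    if ex: "\<exists>w. D (str_code x) w" and f: "\<And>w. D (str_code x) w \<Longrightarrow> f (str_code x) w = str_code y"
    for x y
  proof -
    have "eval r [str_code x] (str_code y)"
      using f[OF LeastI_ex[OF ex]] ex by (simp add: r)
    then have "U_opt p = Some x \<Longrightarrow> ?M p = Some y" for p
      unfolding U_opt_eq machine_iff by (auto intro!: eval_Cn[where ys = "[str_code x]"])
    then have "KC ?M y \<le> KC U_opt x + enat 0"
      by (intro KC_le_transfer) auto
    then have "C y \<le> C x + enat c"
      unfolding C_def using c[of y]
      by (metis add.right_neutral add_right_mono order_trans zero_enat_def)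
    then show ?thesis by (simp add: C_eq)
  qed
  then show ?thesis by blast
qed

section \<open>Initial segments and stagewise approximations\<close>

lemma restr_0 [simp]: "restr Y 0 = []"
  by (simp add: restr_def)

lemma restr_Suc: "restr Y (Suc n) = restr Y n @ [n \<in> Y]"
  by (simp add: restr_def)

lemma restr_eq_iff: "restr Y n = restr Z m \<longleftrightarrow> n = m \<and> (\<forall>i<n. i \<in> Y \<longleftrightarrow> i \<in> Z)"
  by (auto simp: restr_def list_eq_iff_nth_eq)

lemma rfun_str_code_restr [rec_intros]:
  assumes "rdec (Suc n) (\<lambda>v. v 0 \<in> Y (\<lambda>k. v (Suc k)))" and "rfun n b"
  shows "rfun n (\<lambda>v. str_code (restr (Y v) (b v)))"
proof -
  have shift: "rdec (Suc (Suc n)) (\<lambda>v. v 0 \<in> Y (\<lambda>k. v (Suc (Suc k))))"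
    using rfun_shift[of n "\<lambda>i v. of_bool (i \<in> Y v)"] assms(1) by (simp add: rdec_def)
  show ?thesis
  proof (rule rfun_cong)
    show "rfun n (\<lambda>v. rec_nat 0 (\<lambda>m y. 2 * y + (if m \<in> Y v then 2 else 1)) (b v))"
      by (intro rec_intros assms shift) simp_all
    have "rec_nat 0 (\<lambda>m y. 2 * y + (if m \<in> Z then 2 else 1)) k = str_code (restr Z k)" for Z k
      by (induction k) (simp_all add: restr_Suc str_code_snoc)
    then show "rec_nat 0 (\<lambda>m y. 2 * y + (if m \<in> Y v then 2 else 1)) (b v)
        = str_code (restr (Y v) (b v))" for v
      by blast
  qed
qed

text \<open>The disjunct \<open>s \<le> k\<close> makes the minimum exist when no program has halted
  yet. By \<open>str_code_length\<close>, \<open>Suc p < 2 ^ Suc k\<close> says that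
  \<open>p\<close> codes a program of length at most \<open>k\<close>; the weaker bound on
  \<open>p\<close> only gives the quantifier its bounded form.\<close>

definition Cstage :: "nat \<Rightarrow> nat \<Rightarrow> nat" where
  "Cstage s z = (LEAST k. s \<le> k \<or>
    (\<exists>p<2 ^ Suc k. Suc p < 2 ^ Suc k \<and> halts_in s (recf_code u_recf) p z))"

lemma rfun_Cstage [rec_intros]:
  assumes "rfun n a" and "rfun n b"
  shows "rfun n (\<lambda>v. Cstage (a v) (b v))"
proof (rule rfun_comp2[OF _ assms])
  have ex: "\<exists>k. s \<le> k \<or> (\<exists>p<2 ^ Suc k. Suc p < 2 ^ Suc k \<and> halts_in s (recf_code u_recf) p z)" for s z
    by blast
  show "rfun 2 (\<lambda>v. Cstage (v 0) (v 1))"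
    unfolding Cstage_def by (intro rec_intros ex) simp_all
qed

lemma U_opt_iff: "U_opt p = Some x \<longleftrightarrow> (\<exists>s. halts_in s (recf_code u_recf) (str_code p) (str_code x))"
  unfolding U_opt_eq machine_iff eval_iff_halts_in ..

text \<open>Once \<open>s\<close> exceeds the true complexity and a shortest program has halted,
  that program gives the upper bound. Nothing smaller can appear, since every halting computation is
  a genuine description.\<close>

lemma Cstage_converges: "\<forall>\<^sub>F s in sequentially. Cstage s (str_code x) = plainC x"
proof -
  obtain p where p: "U_opt p = Some x" "length p = plainC x"
    using KC_attained[of U_opt x "plainC x"] C_eq[of x] unfolding C_def by blast
  from p(1) obtain t where t: "halts_in t (recf_code u_recf) (str_code p) (str_code x)"
    unfolding U_opt_iff by blast
  have "Cstage s (str_code x) = plainC x" if s: "s \<ge> max t (Suc (plainC x))" for s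
    unfolding Cstage_def
  proof (rule Least_equality)
    have "Suc (str_code p) < 2 ^ Suc (plainC x)"
      using str_code_length[of p "plainC x"] p(2) by (metis order_refl)
    moreover have "halts_in s (recf_code u_recf) (str_code p) (str_code x)"
      using t order_trans[OF max.cobounded1 s] by (rule halts_in_mono)
    ultimately show "s \<le> plainC x \<or> (\<exists>p<2 ^ Suc (plainC x). Suc p < 2 ^ Suc (plainC x) \<and>
        halts_in s (recf_code u_recf) p (str_code x))"
      by (intro disjI2 exI[of _ "str_code p"] conjI) (simp_all only: Suc_lessD)
  next
    fix k
    assume k: "s \<le> k \<or> (\<exists>p<2 ^ Suc k. Suc p < 2 ^ Suc k \<and> halts_in s (recf_code u_recf) p (str_code x))"
    show "plainC x \<le> k"
    proof (cases "s \<le> k")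
      case False
      with k obtain q where q: "Suc q < 2 ^ Suc k" "halts_in s (recf_code u_recf) q (str_code x)"
        by blast
      obtain w where w: "str_code w = q" using surj_str_code by blast
      then have "U_opt w = Some x" using q(2) U_opt_iff by blast
      then have "C x \<le> enat (length w)" unfolding C_def by (rule KC_le)
      moreover have "length w \<le> k" using q(1) unfolding str_code_length w .
      ultimately show ?thesis by (simp add: C_eq)
    qed (use s in simp)
  qed
  then show ?thesis unfolding eventually_sequentially by blast
qed

definition approximates :: "(nat \<Rightarrow> nat set) \<Rightarrow> nat set \<Rightarrow> bool" where
  "approximates Zs Z \<longleftrightarrow> (\<forall>x. \<forall>\<^sub>F s in sequentially. x \<in> Zs s \<longleftrightarrow> x \<in> Z)"

lemma approximates_restr:
  assumes "approximates Zs Z"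
  shows "\<forall>\<^sub>F s in sequentially. restr (Zs s) n = restr Z n"
proof -
  have "\<forall>\<^sub>F s in sequentially. \<forall>i\<in>{..<n}. i \<in> Zs s \<longleftrightarrow> i \<in> Z"
    using assms by (intro eventually_ball_finite) (auto simp: approximates_def)
  then show ?thesis by (rule eventually_mono) (simp add: restr_eq_iff)
qed

lemma approximates_Cstage:
  assumes "approximates Zs Z"
  shows "\<forall>\<^sub>F s in sequentially. Cstage s (str_code (restr (Zs s) n)) = plainC (restr Z n)"
  using approximates_restr[OF assms, of n] Cstage_converges[of "restr Z n"]
  by eventually_elim simp

lemma approximates_increasing:
  assumes "\<And>s. Zs s \<subseteq> Zs (Suc s)"
  shows "approximates Zs (\<Union>s. Zs s)"
  unfolding approximates_def
proof
  fix x
  have mono: "Zs s \<subseteq> Zs t" if "s \<le> t" for s t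
    using that assms by (rule lift_Suc_mono_le[rotated])
  show "\<forall>\<^sub>F s in sequentially. x \<in> Zs s \<longleftrightarrow> x \<in> (\<Union>s. Zs s)"
  proof (cases "x \<in> (\<Union>s. Zs s)")
    case True
    then obtain t where "x \<in> Zs t" by blast
    then have "\<forall>s\<ge>t. x \<in> Zs s" using mono by blast
    with True show ?thesis unfolding eventually_sequentially by blast
  qed auto
qed

lemma computable_rel3_rdec:
  assumes "computable_rel3 R"
  shows "rdec 3 (\<lambda>v. R (v 0) (v 1) (v 2))"
proof -
  obtain r where r: "\<And>x a b. eval r [x, a, b] (of_bool (R x a b))"
    using assms unfolding computable_rel3_def of_bool_def by blast
  have "eval r xs (of_bool (R (env xs 0) (env xs 1) (env xs 2)))" if len: "length xs = 3" for xs
  proof -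
    obtain x a b where "xs = [x, a, b]"
      using len by (auto simp: numeral_3_eq_3 length_Suc_conv)
    then show ?thesis using r[of x a b] by (simp add: numeral_2_eq_2)
  qed
  then show ?thesis unfolding rdec_def rfun_def by blast
qed

lemma Delta02_approximable:
  assumes "Delta02 X"
  obtains Xs where "rdec 2 (\<lambda>v. v 0 \<in> Xs (v 1))" and "approximates Xs X"
proof -
  obtain R Q where R: "computable_rel3 R" "X = {x. \<exists>a. \<forall>b. R x a b}"
    and Q: "computable_rel3 Q" "- X = {x. \<exists>a. \<forall>b. Q x a b}"
    using assms unfolding Delta02_def Sigma02_def by blast
  \<comment> \<open>Witnesses for \<open>x\<close> being in \<open>X\<close> race against witnesses
    for the complement: \<open>a\<close> must look correct so far, and every smaller rival must be
    refuted already.\<close>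
  define Xs where
    "Xs s = {x. \<exists>a<s. (\<forall>b<s. R x a b) \<and> (\<forall>a'<a. \<exists>b<s. \<not> Q x a' b)}" for s
  have "rdec 2 (\<lambda>v. v 0 \<in> Xs (v 1))"
    unfolding Xs_def mem_Collect_eq
    by (intro rec_intros rdec_comp3[OF computable_rel3_rdec[OF R(1)]]
        rdec_comp3[OF computable_rel3_rdec[OF Q(1)]]) simp_all
  moreover have "\<forall>\<^sub>F s in sequentially. x \<in> Xs s \<longleftrightarrow> x \<in> X" for x
  proof (cases "x \<in> X")
    case True
    then obtain a where a: "\<forall>b. R x a b" using R by blast
    have "\<forall>a'. \<exists>b. \<not> Q x a' b" using True Q by blast
    then have "\<forall>\<^sub>F s in sequentially. \<exists>b<s. \<not> Q x a' b" for a'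
      unfolding eventually_sequentially by (meson Suc_le_eq)
    then have "\<forall>\<^sub>F s in sequentially. \<forall>a'\<in>{..<a}. \<exists>b<s. \<not> Q x a' b"
      by (intro eventually_ball_finite) auto
    with eventually_gt_at_top[of a] show ?thesis
      by eventually_elim (use a True in \<open>auto simp: Xs_def\<close>)
  next
    case False
    then obtain a where a: "\<forall>b. Q x a b" using Q by blast
    have "\<forall>a'. \<exists>b. \<not> R x a' b" using False R by blast
    then have "\<forall>\<^sub>F s in sequentially. \<exists>b<s. \<not> R x a' b" for a'
      unfolding eventually_sequentially by (meson Suc_le_eq)
    \<comment> \<open>A candidate above \<open>a\<close> fails because the true rival
      \<open>a\<close> is never refuted, so it suffices to refute the candidates up to
      \<open>a\<close>.\<close>
    then have "\<forall>\<^sub>F s in sequentially. \<forall>a'\<in>{..a}. \<exists>b<s. \<not> R x a' b"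
      by (intro eventually_ball_finite) auto
    then show ?thesis
    proof eventually_elim
      case (elim s)
      have "x \<notin> Xs s"
      proof
        assume "x \<in> Xs s"
        then obtain a' where "\<forall>b<s. R x a' b" "\<forall>c<a'. \<exists>b<s. \<not> Q x c b"
          by (auto simp: Xs_def)
        with elim a show False by (metis atMost_iff not_le)
      qed
      with False show ?case by simp
    qed
  qed
  ultimately show ?thesis using that[of Xs] unfolding approximates_def by blast
qed

lemma ce_enumeration:
  assumes "ce A"
  obtains a where "rdec 2 (\<lambda>v. v 0 \<in> a (v 1))" and "a 0 = {}" and "\<And>s. a s \<subseteq> a (Suc s)"
    and "\<And>s x. x \<in> a s \<Longrightarrow> x < s" and "A = (\<Union>s. a s)"
proof -
  obtain r where r: "A = {x. \<exists>y. eval r [x] y}" using assms unfolding ce_def by blast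
  define a where "a s = {x. x < s \<and> (\<exists>y<s. halts_in s (recf_code r) x y)}" for s
  have "a 0 = {}" and "\<And>s x. x \<in> a s \<Longrightarrow> x < s" by (auto simp: a_def)
  moreover have "rdec 2 (\<lambda>v. v 0 \<in> a (v 1))"
    unfolding a_def mem_Collect_eq by (intro rec_intros) simp_all
  moreover have "a s \<subseteq> a (Suc s)" for s
    unfolding a_def using halts_in_mono[of s _ _ _ "Suc s"] by (auto intro: less_SucI)
  moreover have "A = (\<Union>s. a s)"
  proof (intro equalityI subsetI)
    fix x assume "x \<in> A"
    then obtain y s where y: "halts_in s (recf_code r) x y"
      using r eval_iff_halts_in by blast
    let ?s = "max s (Suc x)"
    have "halts_in ?s (recf_code r) x y" using y by (rule halts_in_mono) simp
    moreover from this have "y < ?s" by (rule halts_in_less)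
    ultimately have "x \<in> a ?s" unfolding a_def by auto
    then show "x \<in> (\<Union>s. a s)" by blast
  next
    fix x assume "x \<in> (\<Union>s. a s)"
    then show "x \<in> A" using r eval_iff_halts_in by (auto simp: a_def)
  qed
  ultimately show ?thesis by (intro that[of a])
qed

section \<open>The splitting construction\<close>

lemma rdec_comp4:
  assumes "rdec 4 (\<lambda>v. P (v 0) (v 1) (v 2) (v 3))"
    and "rfun n a" and "rfun n b" and "rfun n c" and "rfun n d"
  shows "rdec n (\<lambda>v. P (a v) (b v) (c v) (d v))"
  using rfun_compose[of "[a, b, c, d]" "\<lambda>v. of_bool (P (v 0) (v 1) (v 2) (v 3))" n] assms
  by (simp add: rdec_def numeral_eq_Suc)

text \<open>The targets form one family computable uniformly in \<open>e\<close>, because a stage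
  \<open>s\<close> of the construction consults all requirements below \<open>s\<close>.\<close>

locale splitting =
  fixes a :: "nat \<Rightarrow> nat set" and Z :: "nat \<Rightarrow> nat \<Rightarrow> nat set" and Zlim :: "nat \<Rightarrow> nat set"
  assumes a_0: "a 0 = {}"
    and a_Suc: "a s \<subseteq> a (Suc s)"
    and a_less: "x \<in> a s \<Longrightarrow> x < s"
    and rdec_a: "rdec 2 (\<lambda>v. v 0 \<in> a (v 1))"
    and rdec_Z: "rdec 3 (\<lambda>v. v 0 \<in> Z (v 1) (v 2))"
    and Z_approximates: "approximates (Z e) (Zlim e)"
    and Zlim_not_leqC: "\<not> Zlim e \<le>\<^sub>C {}"
begin

text \<open>Requirement \<^term>\<open>e\<close> protects the half \<^term>\<open>A0\<close> if \<^term>\<open>e\<close> is even and the half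
  \<^term>\<open>A1\<close> if it is odd; its goal is that the complexity of the target \<^term>\<open>Zlim e\<close> is not
  bounded by that of the half plus \<^term>\<open>e div 4\<close>. Here \<^term>\<open>B\<close> stands for a finite
  stage of \<^term>\<open>A0\<close>.\<close>

definition half :: "nat set \<Rightarrow> nat \<Rightarrow> nat \<Rightarrow> nat set" where
  "half B e t = {x. x \<in> a t \<and> (if even e then x \<in> B else x \<notin> B)}"

text \<open>The clause \<open>x < t\<close> forces large agreement to occur only at late stages. The
  clause \<open>e < t\<close> ensures that a restraining requirement is among those consulted by
  \<open>to_A1\<close> from then on.\<close>

definition agree :: "nat set \<Rightarrow> nat \<Rightarrow> nat \<Rightarrow> nat \<Rightarrow> bool" where
  "agree B e t x \<longleftrightarrow> x < t \<and> e < t \<and>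
     (\<forall>m\<le>x. Cstage t (str_code (restr (Z e t) m)) \<le>
             Cstage t (str_code (restr (half B e t) m)) + e div 4)"

text \<open>The restraint takes all earlier stages into account: a length of agreement may drop later.\<close>

definition restrained :: "nat set \<Rightarrow> nat \<Rightarrow> nat \<Rightarrow> nat \<Rightarrow> bool" where
  "restrained B e s x \<longleftrightarrow> (\<exists>t\<le>s. agree B e t x)"

text \<open>An even requirement protects \<open>A0\<close> and so sends the element to
  \<open>A1\<close>. Without any restraint the element goes to \<open>A0\<close>.\<close>

definition to_A1 :: "nat set \<Rightarrow> nat \<Rightarrow> nat \<Rightarrow> bool" where
  "to_A1 B s x \<longleftrightarrow>
     (\<exists>e<s. even e \<and> restrained B e s x \<and> (\<forall>e'<e. \<not> restrained B e' s x))"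

text \<open>Only \<open>A0\<close> is recorded; the other half consists of the elements of
  \<open>a\<close> left out, see \<open>half\<close>. The half of an element is decided once, when
  it enters \<open>a\<close>.\<close>

primrec stage0 :: "nat \<Rightarrow> nat set" where
  "stage0 0 = {}"
| "stage0 (Suc s) = {x. x \<le> s \<and>
     (x \<in> stage0 s \<or> x \<in> a (Suc s) \<and> x \<notin> a s \<and> \<not> to_A1 (stage0 s) s x)}"

definition A :: "nat set" where "A = (\<Union>s. a s)"
definition A0 :: "nat set" where "A0 = (\<Union>s. stage0 s)"
definition H :: "nat \<Rightarrow> nat set" where "H e = {x. x \<in> A \<and> (if even e then x \<in> A0 else x \<notin> A0)}"

section \<open>Computability of the construction\<close>

lemma rdec_in_a [rec_intros]: "rfun n f \<Longrightarrow> rfun n g \<Longrightarrow> rdec n (\<lambda>v. f v \<in> a (g v))"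
  by (rule rdec_comp2[OF rdec_a])

lemma rdec_in_Z [rec_intros]:
  "rfun n f \<Longrightarrow> rfun n g \<Longrightarrow> rfun n h \<Longrightarrow> rdec n (\<lambda>v. f v \<in> Z (g v) (h v))"
  by (rule rdec_comp3[OF rdec_Z])

text \<open>\<open>B\<close> is an indexed family so that the same rule serves finite sets given by
  codes, inside the recursion for \<open>stage0\<close>, and the stages themselves
  afterwards.\<close>

lemma rdec_agree:
  assumes "rdec 2 (\<lambda>v. v 0 \<in> B (v 1))"
    and "rfun n b" and "rfun n f" and "rfun n g" and "rfun n h"
  shows "rdec n (\<lambda>v. agree (B (b v)) (f v) (g v) (h v))"
proof (rule rdec_comp4[OF _ assms(2-5)])
  show "rdec 4 (\<lambda>v. agree (B (v 0)) (v 1) (v 2) (v 3))"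
    unfolding agree_def half_def
    by (intro rec_intros rdec_comp2[OF assms(1)]) simp_all
qed

lemma rdec_stage0 [rec_intros]:
  assumes "rfun n f" and "rfun n g"
  shows "rdec n (\<lambda>v. f v \<in> stage0 (g v))"
proof (rule rdec_set_rec[OF _ _ _ assms])
  have "rdec 2 (\<lambda>v. v 0 \<in> set_decode (v 1))" by (intro rec_intros) simp_all
  note [rec_intros] = rdec_agree[OF this]
  show "rdec 3 (\<lambda>v. v 0 \<in> set_decode (v 2) \<or> v 0 \<in> a (Suc (v 1)) \<and> v 0 \<notin> a (v 1) \<and>
      \<not> to_A1 (set_decode (v 2)) (v 1) (v 0))"
    unfolding to_A1_def restrained_def by (intro rec_intros) simp_all
qed simp_all

section \<open>Stages and their limits\<close>

lemma a_mono: "s \<le> t \<Longrightarrow> a s \<subseteq> a t"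
  using a_Suc by (rule lift_Suc_mono_le)

lemma stage0_subset: "stage0 s \<subseteq> a s"
  by (induction s) (use a_Suc in auto)

lemma stage0_Int: "t \<le> s \<Longrightarrow> stage0 s \<inter> a t = stage0 t"
proof (induction rule: dec_induct)
  case base
  show ?case using stage0_subset by blast
next
  case (step s)
  have "x \<in> stage0 s \<Longrightarrow> x \<le> s" for x
    using stage0_subset a_less by (meson less_imp_le subsetD)
  then have "stage0 (Suc s) \<inter> a t = stage0 s \<inter> a t"
    using a_mono[OF step(1)] by auto
  then show ?case using step.IH by simp
qed

lemma A0_Int: "A0 \<inter> a t = stage0 t"
proof
  show "stage0 t \<subseteq> A0 \<inter> a t" using stage0_subset by (auto simp: A0_def)
  show "A0 \<inter> a t \<subseteq> stage0 t"
  proof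
    fix x assume x: "x \<in> A0 \<inter> a t"
    then obtain s where s: "x \<in> stage0 s" by (auto simp: A0_def)
    show "x \<in> stage0 t"
    proof (cases "t \<le> s")
      case True
      then show ?thesis using stage0_Int[OF True] x s by blast
    next
      case False
      then show ?thesis using stage0_Int[of s t] s by auto
    qed
  qed
qed

text \<open>Decisions are never revised, so a later \<open>stage0 s\<close> still shows the half as
  it stood at stage \<open>t\<close>. Hence \<open>restrained\<close>, which inspects the past
  through the current stage, reports the agreements that really occurred.\<close>

lemma half_stage0: "t \<le> s \<Longrightarrow> half (stage0 s) e t = H e \<inter> a t"
  using stage0_Int[of t s] A0_Int[of t] by (auto simp: half_def H_def A_def split: if_splits)

lemma H_approximates: "approximates (\<lambda>t. half (stage0 t) e t) (H e)"
proof -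
  have "(\<Union>t. half (stage0 t) e t) = H e"
    by (auto simp: half_stage0 H_def A_def)
  moreover have "half (stage0 t) e t \<subseteq> half (stage0 (Suc t)) e (Suc t)" for t
    using a_Suc by (simp only: half_stage0[OF order_refl]) blast
  ultimately show ?thesis using approximates_increasing[of "\<lambda>t. half (stage0 t) e t"] by simp
qed

lemma a_approximates: "approximates a A"
  unfolding A_def using a_Suc by (rule approximates_increasing)

lemma restrained_iff: "restrained (stage0 s) e s x \<longleftrightarrow> (\<exists>t\<le>s. agree (stage0 t) e t x)"
  unfolding restrained_def agree_def by (auto simp: half_stage0)

lemma agree_downward: "agree B e t x \<Longrightarrow> y \<le> x \<Longrightarrow> agree B e t y"
  unfolding agree_def by auto

section \<open>Restraints and their finiteness\<close>

lemma entry_stage: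
  assumes "x \<in> A" and "x \<notin> a t"
  obtains s where "t \<le> s" and "x \<in> a (Suc s)" and "x \<notin> a s"
    and "x \<in> A0 \<longleftrightarrow> \<not> to_A1 (stage0 s) s x"
proof -
  define u where "u = (LEAST u. x \<in> a u)"
  have u: "x \<in> a u" using assms(1) unfolding u_def A_def by (auto intro: LeastI)
  moreover have "u \<noteq> 0" using u a_0 by (intro notI) simp
  ultimately obtain s where s: "u = Suc s" by (cases u) auto
  have new: "x \<notin> a s" using s not_less_Least[of s "\<lambda>u. x \<in> a u"] unfolding u_def by auto
  have "t \<le> s"
    using a_mono[of u t] u assms(2) s by (meson not_less_eq_eq subsetD)
  moreover have "x \<le> s" using a_less[OF u] s by simp
  moreover have "x \<notin> stage0 s" using new stage0_subset by blast
  moreover have "x \<in> A0 \<longleftrightarrow> x \<in> stage0 (Suc s)" using A0_Int[of "Suc s"] u s by blast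
  ultimately show ?thesis using that[of s] u s new by auto
qed

text \<open>A requirement whose restraint is unbounded, while the restraints of stronger priority are
  bounded, would make its half computable.\<close>

lemma restraint_preserves:
  assumes bound: "\<And>e' t x. e' < e \<Longrightarrow> agree (stage0 t) e' t x \<Longrightarrow> x < b"
  shows "\<exists>S. \<forall>t\<ge>S. \<forall>x. agree (stage0 t) e t x \<longrightarrow> (\<forall>y\<le>x. y \<in> half (stage0 t) e t \<longleftrightarrow> y \<in> H e)"
proof -
  obtain S where S: "\<And>t. S \<le> t \<Longrightarrow> restr (a t) b = restr A b"
    using approximates_restr[OF a_approximates, of b] unfolding eventually_sequentially by blast
  have "y \<in> half (stage0 t) e t \<longleftrightarrow> y \<in> H e"
    if t: "S \<le> t" and x: "agree (stage0 t) e t x" and y: "y \<le> x" for t x y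
  proof (cases "y \<in> H e \<and> y \<notin> a t")
    case False
    then show ?thesis by (auto simp: half_stage0)
  next
    case True
    then have "y \<in> A" by (simp add: H_def)
    with True obtain s where s: "t \<le> s" "y \<in> a (Suc s)" "y \<notin> a s"
      and A0: "y \<in> A0 \<longleftrightarrow> \<not> to_A1 (stage0 s) s y"
      using entry_stage by blast
    have "b \<le> y"
      \<comment> \<open>\<open>A\<close> has settled below \<open>b\<close> by stage
        \<open>S\<close>, so a later entry is at least \<open>b\<close> and out of reach of all
        stronger restraints.\<close>
      using S[OF t] S[of "Suc s"] t s True \<open>y \<in> A\<close> unfolding restr_eq_iff by (meson not_le)
    then have weak: "\<not> restrained (stage0 s) e' s y" if "e' < e" for e'
      using bound[OF that] unfolding restrained_iff by (meson not_le)
    have e: "restrained (stage0 s) e s y"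
      using agree_downward[OF x y] s(1) unfolding restrained_iff by blast
    have "e < s" using x s(1) unfolding agree_def by simp
    \<comment> \<open>Now \<open>e\<close> is the strongest requirement restraining
      \<open>y\<close>, so \<open>y\<close> is put into the half that \<open>e\<close> does not
      protect.\<close>
    then have "to_A1 (stage0 s) s y \<longleftrightarrow> even e"
      using e weak unfolding to_A1_def by (metis linorder_neqE_nat)
    then have "y \<notin> H e" using A0 by (simp add: H_def)
    with True show ?thesis by simp
  qed
  then show ?thesis by blast
qed

text \<open>A failure at \<open>m\<close> would be visible in the approximations from some stage
  \<open>S\<close> on. But agreement of length at least \<open>max S m\<close> happens after stage
  \<open>S\<close> and covers \<open>m\<close>.\<close>

lemma Zlim_complexity_if_unbounded:
  assumes unbounded: "\<And>b. \<exists>t x. b \<le> x \<and> agree (stage0 t) e t x"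
  shows "plainC (restr (Zlim e) m) \<le> plainC (restr (H e) m) + e div 4"
proof (rule ccontr)
  assume gt: "\<not> ?thesis"
  have "\<forall>\<^sub>F t in sequentially. \<not> Cstage t (str_code (restr (Z e t) m)) \<le>
      Cstage t (str_code (restr (half (stage0 t) e t) m)) + e div 4"
    using approximates_Cstage[OF Z_approximates, of e m] approximates_Cstage[OF H_approximates, of e m]
    by eventually_elim (use gt in simp)
  then obtain S where S: "\<And>t. S \<le> t \<Longrightarrow> \<not> Cstage t (str_code (restr (Z e t) m)) \<le>
      Cstage t (str_code (restr (half (stage0 t) e t) m)) + e div 4"
    unfolding eventually_sequentially by blast
  obtain t x where x: "max S m \<le> x" "agree (stage0 t) e t x" using unbounded by blast
  then have "S \<le> t" "m \<le> x" unfolding agree_def by auto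
  then show False using S x(2) unfolding agree_def by blast
qed

text \<open>Strong induction on priority. With unbounded agreement the half is computable, and the
  target is below it by the previous lemma, hence below the empty set, contrary to
  \<open>Zlim_not_leqC\<close>.\<close>

lemma agreement_bounded: "\<exists>b. \<forall>t x. agree (stage0 t) e t x \<longrightarrow> x < b"
proof (induction e rule: less_induct)
  case (less e)
  then obtain f where f: "\<And>e' t x. e' < e \<Longrightarrow> agree (stage0 t) e' t x \<Longrightarrow> x < f e'"
    by metis
  have b: "x < (\<Sum>e'<e. f e')" if "e' < e" "agree (stage0 t) e' t x" for e' t x
    using f[OF that] member_le_sum[of e' "{..<e}" f] that(1) by simp
  show ?case
  proof (rule ccontr)
    assume "\<not> ?case"
    then have unbounded: "\<exists>t x. b \<le> x \<and> agree (stage0 t) e t x" for b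
      by (meson not_le)
    have "\<exists>S. \<forall>t\<ge>S. \<forall>x. agree (stage0 t) e t x \<longrightarrow> (\<forall>y\<le>x. y \<in> half (stage0 t) e t \<longleftrightarrow> y \<in> H e)"
      by (rule restraint_preserves) (rule b)
    then obtain S where S: "\<forall>t\<ge>S. \<forall>x. agree (stage0 t) e t x \<longrightarrow>
        (\<forall>y\<le>x. y \<in> half (stage0 t) e t \<longleftrightarrow> y \<in> H e)" ..
    \<comment> \<open>Given only the length, look for a stage from \<open>S\<close> on that agrees
      up to it; by the choice of \<open>S\<close> the half is already final there on that initial
      segment.\<close>
    define D where "D z w \<longleftrightarrow> z = str_code (restr {} (p1 w)) \<and> S \<le> p2 w \<and>
        agree (stage0 (p2 w)) e (p2 w) (p1 w)" for z w
    define g where "g z w = str_code (restr (half (stage0 (p2 w)) e (p2 w)) (p1 w))" for z w :: nat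
    have st: "rdec 2 (\<lambda>v. v 0 \<in> stage0 (v 1))" by (intro rec_intros) simp_all
    have D: "rdec 2 (\<lambda>v. D (v 0) (v 1))"
      unfolding D_def by (intro rec_intros rdec_agree[OF st]) simp_all
    have g: "rfun 2 (\<lambda>v. g (v 0) (v 1))"
      unfolding g_def half_def by (intro rec_intros) simp_all
    obtain c where c: "\<forall>x y. (\<exists>w. D (str_code x) w) \<longrightarrow>
        (\<forall>w. D (str_code x) w \<longrightarrow> g (str_code x) w = str_code y) \<longrightarrow> plainC y \<le> plainC x + c"
      using plainC_le_search[OF D g] by meson
    have H: "plainC (restr (H e) n) \<le> plainC (restr {} n) + c" for n
    proof (rule c[rule_format])
      obtain t x where x: "max S n \<le> x" "agree (stage0 t) e t x" using unbounded by blast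
      then have "S \<le> t" "agree (stage0 t) e t n"
        using agree_downward[OF x(2)] by (auto simp: agree_def)
      then have "D (str_code (restr {} n)) (pr n t)" by (simp add: D_def)
      then show "\<exists>w. D (str_code (restr {} n)) w" ..
      show "g (str_code (restr {} n)) w = str_code (restr (H e) n)"
        if "D (str_code (restr {} n)) w" for w
      proof -
        have "p1 w = n" "S \<le> p2 w" "agree (stage0 (p2 w)) e (p2 w) (p1 w)"
          using that by (auto simp: D_def restr_eq_iff)
        then show ?thesis using S by (auto simp: g_def restr_eq_iff)
      qed
    qed
    have "plainC (restr (Zlim e) n) \<le> plainC (restr {} n) + (c + e div 4)" for n
      using Zlim_complexity_if_unbounded[OF unbounded, of n] H[of n] by linarith
    then show False using Zlim_not_leqC leqC_iff by blast
  qed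
qed

text \<open>If the inequality never failed, then the finitely many instances up to the bound
  \<open>b\<close> would all show at some stage, giving agreement at length \<open>b\<close>
  itself.\<close>

lemma requirement_met: "\<exists>m. plainC (restr (H e) m) + e div 4 < plainC (restr (Zlim e) m)"
proof (rule ccontr)
  assume "\<not> ?thesis"
  then have le: "plainC (restr (Zlim e) m) \<le> plainC (restr (H e) m) + e div 4" for m
    by (meson not_le)
  obtain b where b: "\<And>t x. agree (stage0 t) e t x \<Longrightarrow> x < b"
    using agreement_bounded by blast
  have "\<forall>\<^sub>F t in sequentially. \<forall>m\<in>{..b}. Cstage t (str_code (restr (Z e t) m)) \<le>
      Cstage t (str_code (restr (half (stage0 t) e t) m)) + e div 4"
  proof (intro eventually_ball_finite ballI)
    show "\<forall>\<^sub>F t in sequentially. Cstage t (str_code (restr (Z e t) m)) \<le>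
      Cstage t (str_code (restr (half (stage0 t) e t) m)) + e div 4" for m
      using approximates_Cstage[OF Z_approximates, of e m]
        approximates_Cstage[OF H_approximates, of e m]
      by eventually_elim (use le in simp)
  qed simp
  then have "\<forall>\<^sub>F t in sequentially. agree (stage0 t) e t b"
    using eventually_gt_at_top[of b] eventually_gt_at_top[of e]
    by eventually_elim (simp add: agree_def)
  then show False using b by (auto simp: eventually_sequentially)
qed

section \<open>The complexities of the two halves\<close>

lemma ce_H: "ce (H e)"
proof -
  have "H e = {x. \<exists>s. x \<in> half (stage0 s) e s}"
    by (auto simp: half_stage0 H_def A_def)
  moreover have "rdec 2 (\<lambda>v. v 0 \<in> half (stage0 (v 1)) e (v 1))"
    unfolding half_def mem_Collect_eq by (intro rec_intros) simp_all
  ultimately show ?thesis using ce_ex[of "\<lambda>x s. x \<in> half (stage0 s) e s"] by simp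
qed

text \<open>From the initial segment of \<open>A\<close>, wait for a stage at which \<open>a\<close>
  matches it. No further element enters below that length, so the halves are final there.\<close>

lemma H_leqC_A: "H e \<le>\<^sub>C A"
proof -
  define D where "D z w \<longleftrightarrow> z = str_code (restr (a (p2 w)) (p1 w))" for z w
  define g where "g z w = str_code (restr (half (stage0 (p2 w)) e (p2 w)) (p1 w))" for z w :: nat
  have D: "rdec 2 (\<lambda>v. D (v 0) (v 1))"
    unfolding D_def by (intro rec_intros) simp_all
  have g: "rfun 2 (\<lambda>v. g (v 0) (v 1))"
    unfolding g_def half_def by (intro rec_intros) simp_all
  obtain c where c: "\<forall>x y. (\<exists>w. D (str_code x) w) \<longrightarrow>
      (\<forall>w. D (str_code x) w \<longrightarrow> g (str_code x) w = str_code y) \<longrightarrow> plainC y \<le> plainC x + c"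
    using plainC_le_search[OF D g] by meson
  have "plainC (restr (H e) n) \<le> plainC (restr A n) + c" for n
  proof (rule c[rule_format])
    obtain t where "restr (a t) n = restr A n"
      using approximates_restr[OF a_approximates, of n] by (auto simp: eventually_sequentially)
    then have "D (str_code (restr A n)) (pr n t)" by (simp add: D_def)
    then show "\<exists>w. D (str_code (restr A n)) w" ..
    show "g (str_code (restr A n)) w = str_code (restr (H e) n)" if "D (str_code (restr A n)) w" for w
      using that by (auto simp: D_def g_def restr_eq_iff half_stage0 H_def)
  qed
  then show ?thesis unfolding leqC_iff by blast
qed

text \<open>The search waits for the half instead of for \<open>A\<close>. Its correctness is a
  hypothesis on each single \<open>n\<close>, while \<open>c\<close> is the same for all
  \<open>n\<close>: which half settles last may vary with \<open>n\<close>.\<close>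

lemma A_from_last_half:
  obtains c where "\<And>n. (\<And>s. restr (half (stage0 s) e s) n = restr (H e) n \<Longrightarrow>
    restr (a s) n = restr A n) \<Longrightarrow> plainC (restr A n) \<le> plainC (restr (H e) n) + c"
proof -
  define D where "D z w \<longleftrightarrow> z = str_code (restr (half (stage0 (p2 w)) e (p2 w)) (p1 w))" for z w
  define g where "g z w = str_code (restr (a (p2 w)) (p1 w))" for z w :: nat
  have D: "rdec 2 (\<lambda>v. D (v 0) (v 1))"
    unfolding D_def half_def by (intro rec_intros) simp_all
  have g: "rfun 2 (\<lambda>v. g (v 0) (v 1))"
    unfolding g_def by (intro rec_intros) simp_all
  obtain c where c: "\<forall>x y. (\<exists>w. D (str_code x) w) \<longrightarrow>
      (\<forall>w. D (str_code x) w \<longrightarrow> g (str_code x) w = str_code y) \<longrightarrow> plainC y \<le> plainC x + c"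
    using plainC_le_search[OF D g] by meson
  have "plainC (restr A n) \<le> plainC (restr (H e) n) + c"
    if last: "\<And>s. restr (half (stage0 s) e s) n = restr (H e) n \<Longrightarrow> restr (a s) n = restr A n" for n
  proof (rule c[rule_format])
    obtain t where "restr (half (stage0 t) e t) n = restr (H e) n"
      using approximates_restr[OF H_approximates, of e n] by (auto simp: eventually_sequentially)
    then have "D (str_code (restr (H e) n)) (pr n t)" by (simp add: D_def)
    then show "\<exists>w. D (str_code (restr (H e) n)) w" ..
    show "g (str_code (restr (H e) n)) w = str_code (restr A n)"
      if "D (str_code (restr (H e) n)) w" for w
    proof -
      have eq: "restr (half (stage0 (p2 w)) e (p2 w)) (p1 w) = restr (H e) n"
        using that by (simp add: D_def)
      then have "p1 w = n" by (simp add: restr_eq_iff)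
      with eq last[of "p2 w"] show ?thesis by (simp add: g_def)
    qed
  qed
  then show ?thesis using that by blast
qed

text \<open>The half that settles last on \<^term>\<open>{..<n}\<close> knows when the other one has settled.\<close>

lemma A_complexity_le_max:
  obtains c where "\<And>n. plainC (restr A n) \<le>
    max (plainC (restr (H 0) n)) (plainC (restr (H 1) n)) + c"
proof -
  obtain c0 where c0: "\<And>n. (\<And>s. restr (half (stage0 s) 0 s) n = restr (H 0) n \<Longrightarrow>
      restr (a s) n = restr A n) \<Longrightarrow> plainC (restr A n) \<le> plainC (restr (H 0) n) + c0"
    by (rule A_from_last_half[of 0]) blast
  obtain c1 where c1: "\<And>n. (\<And>s. restr (half (stage0 s) 1 s) n = restr (H 1) n \<Longrightarrow>
      restr (a s) n = restr A n) \<Longrightarrow> plainC (restr A n) \<le> plainC (restr (H 1) n) + c1"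
    by (rule A_from_last_half[of 1]) blast
  have "plainC (restr A n) \<le> max (plainC (restr (H 0) n)) (plainC (restr (H 1) n)) + (c0 + c1)" for n
  proof -
    define settled where "settled e s \<longleftrightarrow> restr (half (stage0 s) e s) n = restr (H e) n" for e s
    have settled_mono: "settled e t" if "settled e s" "s \<le> t" for e s t
      using that a_mono[OF that(2)] by (auto simp: settled_def restr_eq_iff half_stage0)
    have both: "restr (a s) n = restr A n" if "settled 0 s" "settled 1 s" for s
    proof -
      have "i \<in> A \<Longrightarrow> i \<in> H 0 \<or> i \<in> H 1" for i by (simp add: H_def)
      moreover have "i \<in> a s \<Longrightarrow> i \<in> A" for i by (auto simp: A_def)
      ultimately show ?thesis
        using that by (auto simp: settled_def restr_eq_iff half_stage0)
    qed
    \<comment> \<open>Each half stays settled once it is, so the two sets of settled stages are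
      final segments and one contains the other.\<close>
    have "(\<forall>s. settled 0 s \<longrightarrow> settled 1 s) \<or> (\<forall>s. settled 1 s \<longrightarrow> settled 0 s)"
      using settled_mono by (meson nat_le_linear)
    then have "plainC (restr A n) \<le> plainC (restr (H 0) n) + c0 \<or>
        plainC (restr A n) \<le> plainC (restr (H 1) n) + c1"
      using c0[of n] c1[of n] both unfolding settled_def by blast
    then show ?thesis by auto
  qed
  then show ?thesis using that by blast
qed

end

theorem theorem6p3:
  fixes A X :: "nat set"
  assumes "ce A" and "\<not> A \<le>\<^sub>C {}"
    and "Delta02 X" and "\<not> X \<le>\<^sub>C {}"
  shows "\<exists>A0 A1. ce A0 \<and> ce A1 \<and> A0 \<inter> A1 = {} \<and> A = A0 \<union> A1 \<and>
           \<not> A0 \<le>\<^sub>C A1 \<and> \<not> A1 \<le>\<^sub>C A0 \<and>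
           (\<forall>Ai \<in> {A0, A1}. Ai \<le>\<^sub>C A \<and> \<not> A \<le>\<^sub>C Ai \<and> \<not> X \<le>\<^sub>C Ai)"
proof -
  obtain a where a: "rdec 2 (\<lambda>v. v 0 \<in> a (v 1))" "a 0 = {}" "\<And>s. a s \<subseteq> a (Suc s)"
    "\<And>s x. x \<in> a s \<Longrightarrow> x < s" "A = (\<Union>s. a s)"
    by (rule ce_enumeration[OF assms(1)], rule that)
  obtain Xs where Xs: "rdec 2 (\<lambda>v. v 0 \<in> Xs (v 1))" "approximates Xs X"
    by (rule Delta02_approximable[OF assms(3)])
  \<comment> \<open>The index \<open>e\<close> carries three data: the parity of \<open>e\<close>
    chooses the half, that of \<open>e div 2\<close> the target, and \<open>e div 4\<close> is the
    constant.\<close>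
  define Z where "Z e s = {x. if even (e div 2) then x \<in> a s else x \<in> Xs s}" for e s :: nat
  define Zlim where "Zlim e = (if even (e div 2) then A else X)" for e :: nat
  have "approximates a A" unfolding a(5) using a(3) by (rule approximates_increasing)
  then have "approximates (Z e) (Zlim e)" for e
    using Xs(2) by (simp add: Z_def Zlim_def approximates_def)
  moreover have "rdec 3 (\<lambda>v. v 0 \<in> Z (v 1) (v 2))"
    unfolding Z_def mem_Collect_eq
    by (intro rec_intros rdec_comp2[OF a(1)] rdec_comp2[OF Xs(1)]) simp_all
  moreover have "\<not> Zlim e \<le>\<^sub>C {}" for e
    using assms by (simp add: Zlim_def)
  ultimately interpret S: splitting a Z Zlim
    using a by unfold_locales auto
  have A: "S.A = A" by (simp add: S.A_def a(5))
  have H_parity: "S.H e = S.H (e mod 2)" for e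
    by (simp add: S.H_def)
  have not_le: "\<not> Y \<le>\<^sub>C S.H i" if "Y \<in> {A, X}" "i \<in> {0, 1}" for Y i
  proof
    assume "Y \<le>\<^sub>C S.H i"
    then obtain c where c: "\<And>n. plainC (restr Y n) \<le> plainC (restr (S.H i) n) + c"
      unfolding leqC_iff by blast
    \<comment> \<open>The requirement with exactly this target, half and constant contradicts the
      assumed inequality.\<close>
    define e where "e = 4 * c + (if Y = A then 0 else 2) + i"
    have "e div 4 = c" "e mod 2 = i" "even (e div 2) \<longleftrightarrow> Y = A"
      using that(2) by (auto simp: e_def) presburger+
    then have "e div 4 = c" "S.H e = S.H i" "Zlim e = Y"
      using that(1) H_parity[of e] by (auto simp: Zlim_def)
    then show False using S.requirement_met[of e] c by (metis not_le)
  qed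
  obtain c where c: "\<And>n. plainC (restr A n) \<le>
      max (plainC (restr (S.H 0) n)) (plainC (restr (S.H 1) n)) + c"
    using S.A_complexity_le_max unfolding A by blast
  have incomparable: "\<not> S.H i \<le>\<^sub>C S.H j" if ij: "{i, j} = {0, 1}" for i j
  proof
    assume "S.H i \<le>\<^sub>C S.H j"
    then obtain d where d: "\<And>n. plainC (restr (S.H i) n) \<le> plainC (restr (S.H j) n) + d"
      unfolding leqC_iff by blast
    \<comment> \<open>The maximum of the two halves' complexities is now that of
      \<open>S.H j\<close> up to \<open>d\<close>, so \<open>A\<close> would lie below a single
      half.\<close>
    have "plainC (restr A n) \<le> plainC (restr (S.H j) n) + (d + c)" for n
      using c[of n] d[of n] ij by (auto simp: doubleton_eq_iff)
    then have "A \<le>\<^sub>C S.H j" unfolding leqC_iff by blast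
    then show False using not_le[of A j] ij by (auto simp: doubleton_eq_iff)
  qed
  have "S.H 0 \<inter> S.H 1 = {}" "A = S.H 0 \<union> S.H 1"
    using A by (auto simp: S.H_def)
  then show ?thesis
    using S.ce_H S.H_leqC_A[unfolded A] not_le incomparable[of 0 1] incomparable[of 1 0]
    by (intro exI[of _ "S.H 0"] exI[of _ "S.H 1"]) auto
qed

end
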